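(* Let $A$ be a unital AF algebra endowed with a faithful tracial state $\mu$. Let $\mathcal{I}=(A_n,\alpha_n)_{n\in\mathbb{N}}$ be an inductive sequence of finite dimensional C*-algebras with C*-inductive limit $A$, with $A_0=\mathbb{C}$ and where $\alpha_n$ is unital and injective for all $n\in\mathbb{N}$. Let $\beta:\mathbb{N}\to(0,\infty)$ tend to $0$ at infinity, and let $(x^k)_{k\in\mathbb{N}}$ and $x$ be elements of $$c_\beta=\{y:\mathbb{N}\to\mathbb{R}:\lim_{n\to\infty}y(n)=0\text{ and }0<y(n)\leq\beta(n)\text{ for all }n\in\mathbb{N}\}$$ such that $(x^k)_{k\in\mathbb{N}}$ converges pointwise to $x$. Then $$\lim_{k\to\infty}\Lambda\left(\left(A,L_{\mathcal{I},\mu}^{x^k}\right),\left(A,L_{\mathcal{I},\mu}^{x}\right)\right)=0.$$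
   Context: $\mathbb{N}=\{0,1,2,\ldots\}$. For a unital C*-algebra $A$, $\mathfrak{sa}(A)$ is its self-adjoint part, $\mathscr{S}(A)$ its state space. Lip-norms: with $\mathcal{I},A,\mu$ as in the claim, let $\iota_n:A_n\to A$ be the canonical maps and let $E_n$ be the unique $\mu$-preserving conditional expectation of $A$ onto $\iota_n(A_n)$. For $y:\mathbb{N}\to(0,\infty)$ with limit $0$, set $L_{\mathcal{I},\mu}^y(a)=\sup_{n\in\mathbb{N}}\|a-E_n(a)\|_A/y(n)$ for $a\in\mathfrak{sa}(A)$. Then $(A,L_{\mathcal{I},\mu}^y)$ is a $(2,0)$-quasi-Leibniz quantum compact metric space. A $(2,0)$-quasi-Leibniz quantum compact metric space is a pair $(A,L)$ of a unital C*-algebra $A$ and a seminorm $L$ defined on a dense Jordan-Lie subalgebra $\mathrm{dom}(L)$ of $\mathfrak{sa}(A)$ (with $L=\infty$ off $\mathrm{dom}(L)$) such that: (1) $\{a\in\mathfrak{sa}(A):L(a)=0\}=\mathbb{R}1_A$; (2) $\max\{L(\frac{ab+ba}{2}),L(\frac{ab-ba}{2i})\}\leq 2(\|a\|_AL(b)+\|b\|_AL(a))$ for all $a,b\in\mathrm{dom}(L)$; (3) $\mathsf{mk}_L(\varphi,\psi)=\sup\{|\varphi(a)-\psi(a)|:a\in\mathrm{dom}(L),L(a)\leq1\}$ metrizes the weak* topology of $\mathscr{S}(A)$; (4) $L$ is lower semi-continuous for $\|\cdot\|_A$. Quantum propinquity $\Lambda$. A bridge from $A$ to $B$ is $\gamma=(D,\pi_A,\pi_B,\omega)$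 where $D$ is a unital C*-algebra, $\pi_A:A\to D$, $\pi_B:B\to D$ are unital *-monomorphisms, and $\omega\in D$ with $\mathscr{S}_1(D|\omega)=\{\varphi\in\mathscr{S}(D):\varphi(1-\omega^*\omega)=\varphi(1-\omega\omega^* )=0\}\neq\emptyset$. The height of $\gamma$ is the maximum of the Hausdorff distance for $\mathsf{mk}_{L_A}$ between $\mathscr{S}(A)$ and $\{\varphi\circ\pi_A:\varphi\in\mathscr{S}_1(D|\omega)\}$ and the Hausdorff distance for $\mathsf{mk}_{L_B}$ between $\mathscr{S}(B)$ and $\{\varphi\circ\pi_B:\varphi\in\mathscr{S}_1(D|\omega)\}$. The reach of $\gamma$ is the Hausdorff distance between $\{a\in\mathfrak{sa}(A):L_A(a)\leq1\}$ and $\{b\in\mathfrak{sa}(B):L_B(b)\leq1\}$ when the distance between $a$ and $b$ is $\|\pi_A(a)\omega-\omega\pi_B(b)\|_D$. The length of $\gamma$ is the maximum of its height and reach. $\Lambda$ is the largest function from pairs of $(2,0)$-quasi-Leibniz quantum compact metric spaces to $[0,\infty)$ which is symmetric, satisfies the triangle inequality, and is bounded above by the length of any bridge between its arguments. *)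

theory Defs
  imports "HOL-Analysis.Analysis" "HOL-Algebra.Module"
begin

section \<open>Unital C*-algebras\<close>

text \<open>
  Algebras are records with an explicit carrier: the operations are only meaningful on the
  carrier, and maps out of an algebra only matter through their values there.
\<close>

record 'a cstar = "(complex, 'a) module" +
  star :: "'a \<Rightarrow> 'a"
  cnorm :: "'a \<Rightarrow> real"

definition complex_cstar :: "complex cstar" where
  "complex_cstar = \<lparr>carrier = UNIV, monoid.mult = (*), one = 1, ring.zero = 0, add = (+),
     smult = (*), star = cnj, cnorm = norm\<rparr>"

text \<open>
  The value \<open>0\<close> off the carrier is there because \<^locale>\<open>Metric_space\<close> asks for a symmetric
  nonnegative function on the whole type.
\<close>

definition cstar_dist :: "'a cstar \<Rightarrow> 'a \<Rightarrow> 'a \<Rightarrow> real" where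
  "cstar_dist A x y =
     (if x \<in> carrier A \<and> y \<in> carrier A then cnorm A (x \<ominus>\<^bsub>A\<^esub> y) else 0)"

definition norm_topology :: "'a cstar \<Rightarrow> 'a topology" where
  "norm_topology A = Metric_space.mtopology (carrier A) (cstar_dist A)"

locale unital_cstar_algebra = ring A + module complex_cstar A
  for A :: "'a cstar" (structure) +
  assumes smult_mult_left:
      "\<lbrakk>x \<in> carrier A; y \<in> carrier A\<rbrakk> \<Longrightarrow> (c \<odot> x) \<otimes> y = c \<odot> (x \<otimes> y)"
    and smult_mult_right:
      "\<lbrakk>x \<in> carrier A; y \<in> carrier A\<rbrakk> \<Longrightarrow> x \<otimes> (c \<odot> y) = c \<odot> (x \<otimes> y)"
    and one_neq_zero: "\<one> \<noteq> \<zero>"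
    and star_closed: "x \<in> carrier A \<Longrightarrow> star A x \<in> carrier A"
    and star_star: "x \<in> carrier A \<Longrightarrow> star A (star A x) = x"
    and star_add:
      "\<lbrakk>x \<in> carrier A; y \<in> carrier A\<rbrakk> \<Longrightarrow> star A (x \<oplus> y) = star A x \<oplus> star A y"
    and star_smult: "x \<in> carrier A \<Longrightarrow> star A (c \<odot> x) = cnj c \<odot> star A x"
    and star_mult:
      "\<lbrakk>x \<in> carrier A; y \<in> carrier A\<rbrakk> \<Longrightarrow> star A (x \<otimes> y) = star A y \<otimes> star A x"
    and cnorm_nonneg: "x \<in> carrier A \<Longrightarrow> 0 \<le> cnorm A x"
    and cnorm_eq_zero: "x \<in> carrier A \<Longrightarrow> cnorm A x = 0 \<longleftrightarrow> x = \<zero>"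
    and cnorm_triangle:
      "\<lbrakk>x \<in> carrier A; y \<in> carrier A\<rbrakk> \<Longrightarrow> cnorm A (x \<oplus> y) \<le> cnorm A x + cnorm A y"
    and cnorm_smult: "x \<in> carrier A \<Longrightarrow> cnorm A (c \<odot> x) = cmod c * cnorm A x"
    and cnorm_mult:
      "\<lbrakk>x \<in> carrier A; y \<in> carrier A\<rbrakk> \<Longrightarrow> cnorm A (x \<otimes> y) \<le> cnorm A x * cnorm A y"
    and cnorm_star_mult: "x \<in> carrier A \<Longrightarrow> cnorm A (star A x \<otimes> x) = (cnorm A x)\<^sup>2"
    and complete: "Metric_space.mcomplete (carrier A) (cstar_dist A)"

lemma unital_cstar_algebra_complex: "unital_cstar_algebra complex_cstar"
proof -
  have cring: "cring complex_cstar"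
    by (intro cringI abelian_groupI comm_monoidI)
      (auto simp: complex_cstar_def algebra_simps intro: exI[of _ "- x" for x])
  then interpret cring complex_cstar .
  have neg: "\<ominus>\<^bsub>complex_cstar\<^esub> x = - x" for x
    by (rule minus_equality) (auto simp: complex_cstar_def)
  have dist: "cstar_dist complex_cstar = dist"
    by (intro ext) (simp add: cstar_dist_def a_minus_def neg dist_norm, simp add: complex_cstar_def)
  have "Metric_space.mcomplete (UNIV :: complex set) dist"
    using complete_UNIV by (simp add: mcomplete_iff_complete)
  then show ?thesis
    unfolding unital_cstar_algebra_def unital_cstar_algebra_axioms_def dist
    by (auto intro!: moduleI cring ring_axioms abelian_group_axioms norm_triangle_ineq
        simp: dist) (auto simp: complex_cstar_def algebra_simps norm_mult power2_eq_square norm_triangle_ineq)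
qed

definition selfadjoint :: "'a cstar \<Rightarrow> 'a set" where
  "selfadjoint A = {a \<in> carrier A. star A a = a}"

definition cstar_positive :: "'a cstar \<Rightarrow> 'a set" where
  "cstar_positive A = {star A a \<otimes>\<^bsub>A\<^esub> a | a. a \<in> carrier A}"

text \<open>\<^const>\<open>ring_hom\<close> includes preservation of the unit.\<close>

definition unital_star_hom :: "'a cstar \<Rightarrow> 'b cstar \<Rightarrow> ('a \<Rightarrow> 'b) \<Rightarrow> bool" where
  "unital_star_hom A B f \<longleftrightarrow> f \<in> ring_hom A B
     \<and> (\<forall>c. \<forall>x\<in>carrier A. f (c \<odot>\<^bsub>A\<^esub> x) = c \<odot>\<^bsub>B\<^esub> f x)
     \<and> (\<forall>x\<in>carrier A. f (star A x) = star B (f x))"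

definition unital_star_mono :: "'a cstar \<Rightarrow> 'b cstar \<Rightarrow> ('a \<Rightarrow> 'b) \<Rightarrow> bool" where
  "unital_star_mono A B f \<longleftrightarrow> unital_star_hom A B f \<and> inj_on f (carrier A)"

definition star_isomorphic :: "'a cstar \<Rightarrow> 'b cstar \<Rightarrow> bool" where
  "star_isomorphic A B \<longleftrightarrow>
     (\<exists>f. unital_star_hom A B f \<and> bij_betw f (carrier A) (carrier B))"

definition finite_dimensional :: "'a cstar \<Rightarrow> bool" where
  "finite_dimensional A \<longleftrightarrow> (\<exists>S. finite S \<and> S \<subseteq> carrier A
     \<and> (\<forall>x\<in>carrier A. \<exists>c. x = (\<Oplus>\<^bsub>A\<^esub>s\<in>S. c s \<odot>\<^bsub>A\<^esub> s)))"


section \<open>States and conditional expectations\<close>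

text \<open>
  A positive linear functional of norm one; a positive functional attains its norm at the unit.
\<close>

definition is_state :: "'a cstar \<Rightarrow> ('a \<Rightarrow> complex) \<Rightarrow> bool" where
  "is_state A \<phi> \<longleftrightarrow>
     (\<forall>x\<in>carrier A. \<forall>y\<in>carrier A. \<phi> (x \<oplus>\<^bsub>A\<^esub> y) = \<phi> x + \<phi> y)
     \<and> (\<forall>c. \<forall>x\<in>carrier A. \<phi> (c \<odot>\<^bsub>A\<^esub> x) = c * \<phi> x)
     \<and> (\<forall>x\<in>cstar_positive A. \<phi> x \<in> \<real> \<and> 0 \<le> Re (\<phi> x))
     \<and> (\<forall>x\<in>carrier A. cmod (\<phi> x) \<le> cnorm A x)
     \<and> \<phi> \<one>\<^bsub>A\<^esub> = 1"

text \<open>States are made extensional so that a functional on the carrier is represented once.\<close>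

definition state_space :: "'a cstar \<Rightarrow> ('a \<Rightarrow> complex) set" where
  "state_space A = {\<phi> \<in> extensional (carrier A). is_state A \<phi>}"

definition weak_star_topology :: "'a cstar \<Rightarrow> ('a \<Rightarrow> complex) topology" where
  "weak_star_topology A =
     subtopology (product_topology (\<lambda>_. euclidean) (carrier A)) (state_space A)"

definition faithful_tracial_state :: "'a cstar \<Rightarrow> ('a \<Rightarrow> complex) \<Rightarrow> bool" where
  "faithful_tracial_state A \<mu> \<longleftrightarrow> is_state A \<mu>
     \<and> (\<forall>x\<in>carrier A. \<forall>y\<in>carrier A. \<mu> (x \<otimes>\<^bsub>A\<^esub> y) = \<mu> (y \<otimes>\<^bsub>A\<^esub> x))
     \<and> (\<forall>x\<in>carrier A. \<mu> (star A x \<otimes>\<^bsub>A\<^esub> x) = 0 \<longrightarrow> x = \<zero>\<^bsub>A\<^esub>)"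

definition conditional_expectation :: "'a cstar \<Rightarrow> 'a set \<Rightarrow> ('a \<Rightarrow> 'a) \<Rightarrow> bool" where
  "conditional_expectation A B E \<longleftrightarrow> E \<in> carrier A \<rightarrow> B
     \<and> (\<forall>x\<in>carrier A. \<forall>y\<in>carrier A. E (x \<oplus>\<^bsub>A\<^esub> y) = E x \<oplus>\<^bsub>A\<^esub> E y)
     \<and> (\<forall>c. \<forall>x\<in>carrier A. E (c \<odot>\<^bsub>A\<^esub> x) = c \<odot>\<^bsub>A\<^esub> E x)
     \<and> (\<forall>x\<in>cstar_positive A. E x \<in> cstar_positive A)
     \<and> (\<forall>x\<in>carrier A. cnorm A (E x) \<le> cnorm A x)
     \<and> (\<forall>b\<in>B. E b = b)
     \<and> (\<forall>x\<in>carrier A. \<forall>b\<in>B. \<forall>c\<in>B. E (b \<otimes>\<^bsub>A\<^esub> x \<otimes>\<^bsub>A\<^esub> c) = b \<otimes>\<^bsub>A\<^esub> E x \<otimes>\<^bsub>A\<^esub> c)"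

text \<open>The conditional expectation of \<open>A\<close> onto \<open>B\<close> that preserves \<open>\<mu>\<close>.\<close>

definition cond_exp_onto :: "'a cstar \<Rightarrow> ('a \<Rightarrow> complex) \<Rightarrow> 'a set \<Rightarrow> 'a \<Rightarrow> 'a" where
  "cond_exp_onto A \<mu> B = (THE E. E \<in> extensional (carrier A)
     \<and> conditional_expectation A B E \<and> (\<forall>x\<in>carrier A. \<mu> (E x) = \<mu> x))"


section \<open>Inductive limits and the Lip-norms\<close>

definition inductive_sequence :: "(nat \<Rightarrow> 'a cstar) \<Rightarrow> (nat \<Rightarrow> 'a \<Rightarrow> 'a) \<Rightarrow> bool" where
  "inductive_sequence F \<alpha> \<longleftrightarrow>
     (\<forall>n. unital_cstar_algebra (F n) \<and> unital_star_hom (F n) (F (Suc n)) (\<alpha> n))"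

text \<open>\<open>connecting \<alpha> n k\<close> is the composite map \<open>F n \<rightarrow> F (n + k)\<close>.\<close>

primrec connecting :: "(nat \<Rightarrow> 'a \<Rightarrow> 'a) \<Rightarrow> nat \<Rightarrow> nat \<Rightarrow> 'a \<Rightarrow> 'a" where
  "connecting \<alpha> n 0 = id"
| "connecting \<alpha> n (Suc k) = \<alpha> (n + k) \<circ> connecting \<alpha> n k"

text \<open>
  The C*-inductive limit is the completion of the algebraic direct limit for the (semi)norm
  that sends the class of \<open>a\<close> in \<open>F n\<close> to the limit of the norms of its images; up to isomorphism
  this says that the canonical maps form a cocone realising that norm, with dense union of ranges.
\<close>

definition inductive_limit ::
  "(nat \<Rightarrow> 'v cstar) \<Rightarrow> (nat \<Rightarrow> 'v \<Rightarrow> 'v) \<Rightarrow> 'a cstar \<Rightarrow> (nat \<Rightarrow> 'v \<Rightarrow> 'a) \<Rightarrow> bool" where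
  "inductive_limit F \<alpha> A \<iota> \<longleftrightarrow> unital_cstar_algebra A
     \<and> (\<forall>n. unital_star_hom (F n) A (\<iota> n))
     \<and> (\<forall>n. \<forall>a\<in>carrier (F n). \<iota> (Suc n) (\<alpha> n a) = \<iota> n a)
     \<and> (\<forall>n. \<forall>a\<in>carrier (F n).
          (\<lambda>k. cnorm (F (n + k)) (connecting \<alpha> n k a)) \<longlonglongrightarrow> cnorm A (\<iota> n a))
     \<and> norm_topology A closure_of (\<Union>n. \<iota> n ` carrier (F n)) = carrier A"

definition af_lip_norm ::
  "'a cstar \<Rightarrow> (nat \<Rightarrow> 'v cstar) \<Rightarrow> (nat \<Rightarrow> 'v \<Rightarrow> 'a) \<Rightarrow> ('a \<Rightarrow> complex) \<Rightarrow> (nat \<Rightarrow> real)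
     \<Rightarrow> 'a \<Rightarrow> ennreal" where
  "af_lip_norm A F \<iota> \<mu> y a = (if a \<in> selfadjoint A
     then (SUP n. ennreal (cnorm A (a \<ominus>\<^bsub>A\<^esub> cond_exp_onto A \<mu> (\<iota> n ` carrier (F n)) a) / y n))
     else \<infinity>)"

definition c_seq :: "(nat \<Rightarrow> real) \<Rightarrow> (nat \<Rightarrow> real) set" where
  "c_seq \<beta> = {y. y \<longlonglongrightarrow> 0 \<and> (\<forall>n. 0 < y n \<and> y n \<le> \<beta> n)}"


section \<open>Quasi-Leibniz quantum compact metric spaces\<close>

text \<open>The second component is \<open>\<infinity>\<close> off its domain, in particular off the self-adjoint part.\<close>

type_synonym 'a qcms = "'a cstar \<times> ('a \<Rightarrow> ennreal)"

definition dom_lip :: "('a \<Rightarrow> ennreal) \<Rightarrow> 'a set" where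
  "dom_lip L = {a. L a < \<infinity>}"

definition jordan_product :: "'a cstar \<Rightarrow> 'a \<Rightarrow> 'a \<Rightarrow> 'a" where
  "jordan_product A a b = (1 / 2) \<odot>\<^bsub>A\<^esub> (a \<otimes>\<^bsub>A\<^esub> b \<oplus>\<^bsub>A\<^esub> b \<otimes>\<^bsub>A\<^esub> a)"

definition lie_product :: "'a cstar \<Rightarrow> 'a \<Rightarrow> 'a \<Rightarrow> 'a" where
  "lie_product A a b = (1 / (2 * \<i>)) \<odot>\<^bsub>A\<^esub> (a \<otimes>\<^bsub>A\<^esub> b \<ominus>\<^bsub>A\<^esub> b \<otimes>\<^bsub>A\<^esub> a)"

definition jordan_lie_subalgebra :: "'a cstar \<Rightarrow> 'a set \<Rightarrow> bool" where
  "jordan_lie_subalgebra A S \<longleftrightarrow> S \<subseteq> selfadjoint A \<and> \<zero>\<^bsub>A\<^esub> \<in> S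
     \<and> (\<forall>a\<in>S. \<forall>b\<in>S. a \<oplus>\<^bsub>A\<^esub> b \<in> S)
     \<and> (\<forall>t::real. \<forall>a\<in>S. complex_of_real t \<odot>\<^bsub>A\<^esub> a \<in> S)
     \<and> (\<forall>a\<in>S. \<forall>b\<in>S. jordan_product A a b \<in> S \<and> lie_product A a b \<in> S)"

definition monge_kantorovich ::
  "('a \<Rightarrow> ennreal) \<Rightarrow> ('a \<Rightarrow> complex) \<Rightarrow> ('a \<Rightarrow> complex) \<Rightarrow> ennreal" where
  "monge_kantorovich L \<phi> \<psi> =
     (SUP a\<in>{a \<in> dom_lip L. L a \<le> 1}. ennreal (cmod (\<phi> a - \<psi> a)))"

definition metrizes_weak_star :: "'a cstar \<Rightarrow> ('a \<Rightarrow> ennreal) \<Rightarrow> bool" where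
  "metrizes_weak_star A L \<longleftrightarrow>
     (\<forall>\<phi>\<in>state_space A. \<forall>\<psi>\<in>state_space A. monge_kantorovich L \<phi> \<psi> < \<infinity>)
     \<and> Metric_space (state_space A) (\<lambda>\<phi> \<psi>. enn2real (monge_kantorovich L \<phi> \<psi>))
     \<and> Metric_space.mtopology (state_space A) (\<lambda>\<phi> \<psi>. enn2real (monge_kantorovich L \<phi> \<psi>))
         = weak_star_topology A"

definition quasi_leibniz_qcms :: "'a qcms \<Rightarrow> bool" where
  "quasi_leibniz_qcms = (\<lambda>(A, L). unital_cstar_algebra A
     \<and> jordan_lie_subalgebra A (dom_lip L)
     \<and> selfadjoint A \<subseteq> norm_topology A closure_of dom_lip L
     \<and> (\<forall>a\<in>dom_lip L. \<forall>b\<in>dom_lip L. L (a \<oplus>\<^bsub>A\<^esub> b) \<le> L a + L b)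
     \<and> (\<forall>t::real. \<forall>a\<in>dom_lip L. L (complex_of_real t \<odot>\<^bsub>A\<^esub> a) = ennreal \<bar>t\<bar> * L a)
     \<and> {a \<in> selfadjoint A. L a = 0} = range (\<lambda>t::real. complex_of_real t \<odot>\<^bsub>A\<^esub> \<one>\<^bsub>A\<^esub>)
     \<and> (\<forall>a\<in>dom_lip L. \<forall>b\<in>dom_lip L.
          max (L (jordan_product A a b)) (L (lie_product A a b))
            \<le> 2 * (ennreal (cnorm A a) * L b + ennreal (cnorm A b) * L a))
     \<and> metrizes_weak_star A L
     \<and> (\<forall>r. openin (subtopology (norm_topology A) (selfadjoint A)) {a \<in> selfadjoint A. r < L a}))"


section \<open>The quantum propinquity\<close>

text \<open>
  A Hausdorff distance between subsets of possibly different sets, relative to a given function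
  measuring how far a point of the first is from a point of the second.
\<close>

definition hausdorff_distance ::
  "('a \<Rightarrow> 'b \<Rightarrow> ennreal) \<Rightarrow> 'a set \<Rightarrow> 'b set \<Rightarrow> ennreal" where
  "hausdorff_distance d S T = max (SUP s\<in>S. INF t\<in>T. d s t) (SUP t\<in>T. INF s\<in>S. d s t)"

definition level_states :: "'a cstar \<Rightarrow> 'a \<Rightarrow> ('a \<Rightarrow> complex) set" where
  "level_states D \<omega> = {\<phi> \<in> state_space D.
     \<phi> (\<one>\<^bsub>D\<^esub> \<ominus>\<^bsub>D\<^esub> star D \<omega> \<otimes>\<^bsub>D\<^esub> \<omega>) = 0 \<and> \<phi> (\<one>\<^bsub>D\<^esub> \<ominus>\<^bsub>D\<^esub> \<omega> \<otimes>\<^bsub>D\<^esub> star D \<omega>) = 0}"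

text \<open>
  All algebras involved in a propinquity, including the algebras of the bridges and the
  intermediate spaces, have carriers in one type \<open>'u\<close>. This loses nothing: the algebra of a
  quantum compact metric space is separable, and the algebra of a bridge between two of them can be
  cut down to the subalgebra generated by the two images and the pivot without changing the length.
  A separable C*-algebra has at most the cardinality of the continuum, whereas a type carrying a
  single nonzero C*-algebra has at least that cardinality.
\<close>

record 'u bridge =
  bridge_algebra :: "'u cstar"
  left_map :: "'u \<Rightarrow> 'u"
  right_map :: "'u \<Rightarrow> 'u"
  pivot :: "'u"

definition is_bridge :: "'u cstar \<Rightarrow> 'u cstar \<Rightarrow> 'u bridge \<Rightarrow> bool" where
  "is_bridge A B \<gamma> \<longleftrightarrow> unital_cstar_algebra (bridge_algebra \<gamma>)
     \<and> unital_star_mono A (bridge_algebra \<gamma>) (left_map \<gamma>)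
     \<and> unital_star_mono B (bridge_algebra \<gamma>) (right_map \<gamma>)
     \<and> pivot \<gamma> \<in> carrier (bridge_algebra \<gamma>)
     \<and> level_states (bridge_algebra \<gamma>) (pivot \<gamma>) \<noteq> {}"

fun bridge_height :: "'u qcms \<Rightarrow> 'u qcms \<Rightarrow> 'u bridge \<Rightarrow> ennreal" where
  "bridge_height (A, L\<^sub>A) (B, L\<^sub>B) \<gamma> = max
     (hausdorff_distance (monge_kantorovich L\<^sub>A) (state_space A)
        {compose (carrier A) \<phi> (left_map \<gamma>) | \<phi>.
           \<phi> \<in> level_states (bridge_algebra \<gamma>) (pivot \<gamma>)})
     (hausdorff_distance (monge_kantorovich L\<^sub>B) (state_space B)
        {compose (carrier B) \<phi> (right_map \<gamma>) | \<phi>.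
           \<phi> \<in> level_states (bridge_algebra \<gamma>) (pivot \<gamma>)})"

fun bridge_reach :: "'u qcms \<Rightarrow> 'u qcms \<Rightarrow> 'u bridge \<Rightarrow> ennreal" where
  "bridge_reach (A, L\<^sub>A) (B, L\<^sub>B) \<gamma> = (let D = bridge_algebra \<gamma>; \<omega> = pivot \<gamma> in
     hausdorff_distance
       (\<lambda>a b. ennreal (cnorm D (left_map \<gamma> a \<otimes>\<^bsub>D\<^esub> \<omega> \<ominus>\<^bsub>D\<^esub> \<omega> \<otimes>\<^bsub>D\<^esub> right_map \<gamma> b)))
       {a \<in> selfadjoint A. L\<^sub>A a \<le> 1} {b \<in> selfadjoint B. L\<^sub>B b \<le> 1})"

definition bridge_length :: "'u qcms \<Rightarrow> 'u qcms \<Rightarrow> 'u bridge \<Rightarrow> ennreal" where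
  "bridge_length X Y \<gamma> = max (bridge_height X Y \<gamma>) (bridge_reach X Y \<gamma>)"

definition propinquity_bounded :: "('u qcms \<Rightarrow> 'u qcms \<Rightarrow> real) \<Rightarrow> bool" where
  "propinquity_bounded g \<longleftrightarrow>
     (\<forall>X Y. quasi_leibniz_qcms X \<and> quasi_leibniz_qcms Y \<longrightarrow>
        0 \<le> g X Y \<and> g X Y = g Y X
        \<and> (\<forall>\<gamma>. is_bridge (fst X) (fst Y) \<gamma> \<longrightarrow> ennreal (g X Y) \<le> bridge_length X Y \<gamma>))
     \<and> (\<forall>X Y Z. quasi_leibniz_qcms X \<and> quasi_leibniz_qcms Y \<and> quasi_leibniz_qcms Z \<longrightarrow>
        g X Z \<le> g X Y + g Y Z)"

text \<open>
  The largest function with the required properties is the pointwise supremum of all of them. The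
  supremum is taken in \<^typ>\<open>ennreal\<close>, so that it never is a default value. The lemmas below: a
  largest function, if there is one, coincides with this supremum on the spaces concerned, and the
  supremum has the required properties if it is finite.
\<close>

definition quantum_propinquity :: "'u qcms \<Rightarrow> 'u qcms \<Rightarrow> ennreal" where
  "quantum_propinquity X Y = (SUP g\<in>{g. propinquity_bounded g}. ennreal (g X Y))"

lemma quantum_propinquity_eq_largest:
  assumes "propinquity_bounded \<Lambda>"
    and "\<And>g X Y. \<lbrakk>propinquity_bounded g; quasi_leibniz_qcms X; quasi_leibniz_qcms Y\<rbrakk>
      \<Longrightarrow> g X Y \<le> \<Lambda> X Y"
    and "quasi_leibniz_qcms X" "quasi_leibniz_qcms Y"
  shows "quantum_propinquity X Y = ennreal (\<Lambda> X Y)"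
  unfolding quantum_propinquity_def
  by (rule antisym) (auto intro!: SUP_least SUP_upper ennreal_leI assms)

lemma propinquity_bounded_quantum_propinquity:
  assumes "\<And>X Y :: 'u qcms. \<lbrakk>quasi_leibniz_qcms X; quasi_leibniz_qcms Y\<rbrakk>
      \<Longrightarrow> quantum_propinquity X Y < \<infinity>"
  shows "propinquity_bounded (\<lambda>X Y :: 'u qcms. enn2real (quantum_propinquity X Y))"
proof -
  have sym: "quantum_propinquity X Y = quantum_propinquity Y X"
    if "quasi_leibniz_qcms X" "quasi_leibniz_qcms Y" for X Y :: "'u qcms"
    unfolding quantum_propinquity_def
  proof (rule SUP_cong)
    fix g :: "'u qcms \<Rightarrow> 'u qcms \<Rightarrow> real" assume "g \<in> {g. propinquity_bounded g}"
    then have "g X Y = g Y X" using that unfolding propinquity_bounded_def by blast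
    then show "ennreal (g X Y) = ennreal (g Y X)" by simp
  qed simp
  have tri: "quantum_propinquity X Z \<le> quantum_propinquity X Y + quantum_propinquity Y Z"
    if "quasi_leibniz_qcms X" "quasi_leibniz_qcms Y" "quasi_leibniz_qcms Z" for X Y Z :: "'u qcms"
    unfolding quantum_propinquity_def[of X Z]
  proof (rule SUP_least)
    fix g :: "'u qcms \<Rightarrow> 'u qcms \<Rightarrow> real" assume g: "g \<in> {g. propinquity_bounded g}"
    have "ennreal (g X Z) \<le> ennreal (g X Y + g Y Z)"
      using g that unfolding propinquity_bounded_def by (intro ennreal_leI) blast
    also have "\<dots> = ennreal (g X Y) + ennreal (g Y Z)"
      using g that unfolding propinquity_bounded_def by (intro ennreal_plus) blast+
    also have "\<dots> \<le> quantum_propinquity X Y + quantum_propinquity Y Z"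
      unfolding quantum_propinquity_def using g by (intro add_mono SUP_upper)
    finally show "ennreal (g X Z) \<le> quantum_propinquity X Y + quantum_propinquity Y Z" .
  qed
  have len: "quantum_propinquity X Y \<le> bridge_length X Y \<gamma>"
    if "quasi_leibniz_qcms X" "quasi_leibniz_qcms Y" "is_bridge (fst X) (fst Y) \<gamma>"
    for X Y :: "'u qcms" and \<gamma>
    unfolding quantum_propinquity_def
    by (rule SUP_least) (use that in \<open>unfold propinquity_bounded_def, blast\<close>)
  have tri': "enn2real (quantum_propinquity X Z)
      \<le> enn2real (quantum_propinquity X Y) + enn2real (quantum_propinquity Y Z)"
    if "quasi_leibniz_qcms X" "quasi_leibniz_qcms Y" "quasi_leibniz_qcms Z" for X Y Z :: "'u qcms"
  proof -
    have "enn2real (quantum_propinquity X Z)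
        \<le> enn2real (quantum_propinquity X Y + quantum_propinquity Y Z)"
      using tri[OF that] assms[OF that(1,2)] assms[OF that(2,3)] by (intro enn2real_mono) auto
    then show ?thesis
      using assms[OF that(1,2)] assms[OF that(2,3)] by (simp add: enn2real_plus)
  qed
  show ?thesis
    unfolding propinquity_bounded_def
    by (intro conjI allI impI) (use sym tri' len assms in \<open>auto simp: less_top\<close>)
qed

end

theory Submission
  imports Defs
begin

text \<open>
  Write \<open>E n\<close> for the trace-preserving conditional expectation onto the
  \<open>n\<close>-th stage of the inductive sequence. The unit ball of the Lip-norm of \<open>y\<close> consists of the
  self-adjoint \<open>a\<close> with \<open>\<parallel>a - E n a\<parallel> \<le> y n\<close> for all \<open>n\<close>. The bridge given by the algebra itself with
  pivot \<open>1\<close> has height \<open>0\<close>, so the propinquity between two such Lip-norms is at most the Hausdorff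
  distance between their unit balls in norm. Let \<open>a\<close> be in the ball of \<open>y\<close>. Then \<open>E N a\<close> is within
  \<open>y N\<close> of \<open>a\<close> and need only satisfy the conditions with \<open>n < N\<close> to lie in the ball of \<open>z\<close>. Since
  \<open>E n (E N a) = E n a\<close> for these \<open>n\<close> and \<open>E N\<close> is contractive, \<open>\<parallel>E N a - E n (E N a)\<parallel> \<le> y n\<close>; moving
  \<open>E N a\<close> towards the scalar \<open>E 0 a\<close> by a factor \<open>t\<close> with \<open>t * y n \<le> z n\<close> gives an element
  of the ball of \<open>z\<close>, and costs at most \<open>(1 - t) * y 0\<close> (\<open>lip_ball_approx\<close>). The common bound \<open>\<beta>\<close> makes
  \<open>N\<close> independent of \<open>k\<close>, and pointwise convergence at finitely many points makes \<open>t\<close> tend to \<open>1\<close>.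

  The propinquity is only bounded by lengths of bridges between quasi-Leibniz quantum compact metric
  spaces. Most of the work therefore is to show that the Lip-norms define such spaces
  (\<open>quasi_leibniz_qcms_L\<close>). Both the Leibniz inequality and the comparison of the
  Monge--Kantorovich metric with the weak* topology come down to contractivity of the
  expectations: for the former one compares \<open>ab\<close> with \<open>E n a E n b\<close>; for the latter, the unit
  ball is, modulo scalars, within \<open>y N\<close> of a bounded set in a finite-dimensional space.

  The expectation onto a finite-dimensional subalgebra \<open>B\<close> is the orthogonal projection for the
  inner product \<open>\<mu> (x\<^sup>* y)\<close>. The trace property makes it a bimodule map, hence left multiplication by
  \<open>E x\<close> on \<open>B\<close> is a compression of left multiplication by \<open>x\<close>, of norm at most \<open>\<parallel>x\<parallel>\<close>. This operator
  norm dominates the C*-norm of \<open>E x\<close>: on \<open>B\<close> the C*-norm is at most a constant times the norm of the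
  inner product, and \<open>\<parallel>h ^ (2 ^ k)\<parallel> = \<parallel>h\<parallel> ^ (2 ^ k)\<close> for self-adjoint \<open>h\<close> removes the constant
  (\<open>cnorm_le_if_l2_bounded\<close>). Positivity follows from the same norm estimate for \<open>E (1 - x\<^sup>* x / \<parallel>x\<parallel>\<^sup>2)\<close> and
  from the existence of a square root of \<open>1 - t\<close> for self-adjoint \<open>t\<close> of norm at most \<open>1\<close>
  (\<open>square_root_one_minus\<close>).
\<close>

section \<open>Arithmetic in a unital C*-algebra\<close>

lemma complex_cstar_simps [simp]:
  "carrier complex_cstar = UNIV" "\<one>\<^bsub>complex_cstar\<^esub> = 1" "\<zero>\<^bsub>complex_cstar\<^esub> = 0"
  "x \<oplus>\<^bsub>complex_cstar\<^esub> y = x + y" "x \<otimes>\<^bsub>complex_cstar\<^esub> y = x * y"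
  by (simp_all add: complex_cstar_def)

context unital_cstar_algebra
begin

lemma scale_closed [simp, intro]: "x \<in> carrier A \<Longrightarrow> c \<odot> x \<in> carrier A"
  using smult_closed[of c x] by simp

lemma star_carrier [simp, intro]: "x \<in> carrier A \<Longrightarrow> star A x \<in> carrier A"
  by (rule star_closed)

lemma mult_assoc: "\<lbrakk>x \<in> carrier A; y \<in> carrier A; z \<in> carrier A\<rbrakk> \<Longrightarrow> x \<otimes> y \<otimes> z = x \<otimes> (y \<otimes> z)"
  by algebra

lemma mult_distrib_right: "\<lbrakk>x \<in> carrier A; y \<in> carrier A; z \<in> carrier A\<rbrakk> \<Longrightarrow> (x \<oplus> y) \<otimes> z = x \<otimes> z \<oplus> y \<otimes> z"
  by algebra

lemma mult_distrib_left: "\<lbrakk>x \<in> carrier A; y \<in> carrier A; z \<in> carrier A\<rbrakk> \<Longrightarrow> z \<otimes> (x \<oplus> y) = z \<otimes> x \<oplus> z \<otimes> y"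
  by algebra

lemma add_interchange:
  "\<lbrakk>x \<in> carrier A; y \<in> carrier A; z \<in> carrier A; w \<in> carrier A\<rbrakk>
    \<Longrightarrow> x \<oplus> y \<oplus> (z \<oplus> w) = x \<oplus> z \<oplus> (y \<oplus> w)"
  by algebra

lemma scale_add_left: "x \<in> carrier A \<Longrightarrow> (c + d) \<odot> x = c \<odot> x \<oplus> d \<odot> x"
  using smult_l_distr[of c d x] by simp

lemma scale_add_right: "\<lbrakk>x \<in> carrier A; y \<in> carrier A\<rbrakk> \<Longrightarrow> c \<odot> (x \<oplus> y) = c \<odot> x \<oplus> c \<odot> y"
  using smult_r_distr[of c x y] by simp

lemma scale_scale: "x \<in> carrier A \<Longrightarrow> c \<odot> (d \<odot> x) = (c * d) \<odot> x"
  using smult_assoc1[of c d x] by simp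

lemma scale_1: "x \<in> carrier A \<Longrightarrow> 1 \<odot> x = x"
  using smult_one[of x] by simp

lemma scale_0: "x \<in> carrier A \<Longrightarrow> 0 \<odot> x = \<zero>"
  using smult_l_null[of x] by simp

lemma scale_zero: "c \<odot> \<zero> = \<zero>"
  using smult_r_null[of c] by simp

lemma uminus_eq_scale: "x \<in> carrier A \<Longrightarrow> \<ominus> x = (-1) \<odot> x"
proof -
  assume x: "x \<in> carrier A"
  have "(-1) \<odot> x \<oplus> x = (-1 + 1) \<odot> x"
    using x by (simp only: scale_add_left scale_1)
  then have "(-1) \<odot> x \<oplus> x = \<zero>" using x by (simp add: scale_0)
  moreover have "(-1) \<odot> x = (-1) \<odot> x \<oplus> x \<ominus> x"
    using x scale_closed[of x "-1"] by algebra
  ultimately show ?thesis using x by (simp add: a_minus_def)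
qed

lemma minus_eq_scale: "\<lbrakk>x \<in> carrier A; y \<in> carrier A\<rbrakk> \<Longrightarrow> x \<ominus> y = x \<oplus> (-1) \<odot> y"
  by (simp add: a_minus_def uminus_eq_scale)

lemma scale_minus_right:
  "\<lbrakk>x \<in> carrier A; y \<in> carrier A\<rbrakk> \<Longrightarrow> c \<odot> (x \<ominus> y) = c \<odot> x \<ominus> c \<odot> y"
  by (simp add: minus_eq_scale scale_add_right scale_scale)

lemma scale_minus_left: "x \<in> carrier A \<Longrightarrow> (c - d) \<odot> x = c \<odot> x \<ominus> d \<odot> x"
  using scale_add_left[of x c "-d"] by (simp add: minus_eq_scale scale_scale)

lemma one_minus_one_minus: "w \<in> carrier A \<Longrightarrow> \<one> \<ominus> (\<one> \<ominus> w) = w"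
  by algebra

lemma star_minus: "\<lbrakk>x \<in> carrier A; y \<in> carrier A\<rbrakk> \<Longrightarrow> star A (x \<ominus> y) = star A x \<ominus> star A y"
  by (simp add: minus_eq_scale star_add star_smult)

lemma star_zero [simp]: "star A \<zero> = \<zero>"
  using star_smult[of \<zero> 0] by (simp add: scale_0)

lemma star_one [simp]: "star A \<one> = \<one>"
  using star_mult[of \<one> "star A \<one>"] by (simp add: star_star)

lemma cnorm_zero [simp]: "cnorm A \<zero> = 0"
  by (simp add: cnorm_eq_zero)

lemma cnorm_uminus: "x \<in> carrier A \<Longrightarrow> cnorm A (\<ominus> x) = cnorm A x"
  by (simp add: uminus_eq_scale cnorm_smult)

lemma cnorm_minus_commute:
  assumes "x \<in> carrier A" "y \<in> carrier A"
  shows "cnorm A (x \<ominus> y) = cnorm A (y \<ominus> x)"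
proof -
  have "x \<ominus> y = \<ominus> (y \<ominus> x)" using assms by algebra
  then show ?thesis using assms by (simp add: cnorm_uminus)
qed

lemma cnorm_minus_le:
  assumes "x \<in> carrier A" "y \<in> carrier A"
  shows "cnorm A (x \<ominus> y) \<le> cnorm A x + cnorm A y"
  using cnorm_triangle[of x "\<ominus> y"] assms by (simp add: a_minus_def cnorm_uminus)

lemma cnorm_minus_triangle:
  assumes "x \<in> carrier A" "y \<in> carrier A" "z \<in> carrier A"
  shows "cnorm A (x \<ominus> z) \<le> cnorm A (x \<ominus> y) + cnorm A (y \<ominus> z)"
proof -
  have "x \<ominus> z = (x \<ominus> y) \<oplus> (y \<ominus> z)" using assms by algebra
  then show ?thesis using assms cnorm_triangle[of "x \<ominus> y" "y \<ominus> z"] by simp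
qed

lemma cnorm_minus_eq_zero:
  assumes "x \<in> carrier A" "y \<in> carrier A"
  shows "cnorm A (x \<ominus> y) = 0 \<longleftrightarrow> x = y"
proof -
  have "(x \<ominus> y) \<oplus> y = x" "y \<ominus> y = \<zero>" using assms by algebra+
  then show ?thesis using assms by (auto simp: cnorm_eq_zero)
qed

lemma eq_if_norm_minus_small:
  assumes "x \<in> carrier A" "y \<in> carrier A" and small: "\<And>e. 0 < e \<Longrightarrow> cnorm A (x \<ominus> y) \<le> e"
  shows "x = y"
proof -
  have "cnorm A (x \<ominus> y) \<le> 0" by (rule field_le_epsilon) (simp add: small)
  then show ?thesis using assms(1,2) cnorm_nonneg[of "x \<ominus> y"] cnorm_minus_eq_zero[of x y] by simp
qed

lemma cnorm_star:
  assumes x: "x \<in> carrier A" shows "cnorm A (star A x) = cnorm A x"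
proof -
  have le: "cnorm A y \<le> cnorm A (star A y)" if y: "y \<in> carrier A" for y
  proof (cases "cnorm A y = 0")
    case True then show ?thesis using y cnorm_nonneg by simp
  next
    case False
    have "cnorm A y * cnorm A y \<le> cnorm A (star A y) * cnorm A y"
      using cnorm_mult[of "star A y" y] cnorm_star_mult[OF y] y by (simp add: power2_eq_square)
    then show ?thesis using False cnorm_nonneg[OF y] by simp
  qed
  from le[OF x] le[of "star A x"] x show ?thesis by (simp add: star_star)
qed

lemma cnorm_one [simp]: "cnorm A \<one> = 1"
  using cnorm_star_mult[of \<one>] cnorm_eq_zero[of \<one>] one_neq_zero
  by (simp add: power2_eq_square)

lemma cnorm_selfadjoint_square:
  "\<lbrakk>h \<in> carrier A; star A h = h\<rbrakk> \<Longrightarrow> cnorm A (h \<otimes> h) = (cnorm A h)\<^sup>2"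
  using cnorm_star_mult[of h] by simp

lemma Metric_space_cstar: "Metric_space (carrier A) (cstar_dist A)"
proof
  show "0 \<le> cstar_dist A x y" for x y by (simp add: cstar_dist_def cnorm_nonneg)
  show "cstar_dist A x y = cstar_dist A y x" for x y
    by (simp add: cstar_dist_def cnorm_minus_commute)
  show "cstar_dist A x y = 0 \<longleftrightarrow> x = y" if "x \<in> carrier A" "y \<in> carrier A" for x y
    using that by (simp add: cstar_dist_def cnorm_minus_eq_zero)
  show "cstar_dist A x z \<le> cstar_dist A x y + cstar_dist A y z"
    if "x \<in> carrier A" "y \<in> carrier A" "z \<in> carrier A" for x y z
    using that by (simp add: cstar_dist_def cnorm_minus_triangle)
qed

lemma Cauchy_imp_norm_convergent:
  assumes Y: "\<And>n. Y n \<in> carrier A"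
    and Cauchy: "\<And>e. 0 < e \<Longrightarrow> \<exists>N. \<forall>m\<ge>N. \<forall>n\<ge>N. cnorm A (Y m \<ominus> Y n) < e"
  obtains l where "l \<in> carrier A" "(\<lambda>n. cnorm A (Y n \<ominus> l)) \<longlonglongrightarrow> 0"
proof -
  interpret M: Metric_space "carrier A" "cstar_dist A" by (rule Metric_space_cstar)
  have "M.MCauchy Y"
    unfolding M.MCauchy_def using Y Cauchy by (auto simp: cstar_dist_def)
  then obtain l where "limitin M.mtopology Y l sequentially"
    using complete unfolding M.mcomplete_def by blast
  then have l: "l \<in> carrier A" and lim: "\<And>e. 0 < e \<Longrightarrow> \<exists>N. \<forall>n\<ge>N. cstar_dist A (Y n) l < e"
    unfolding M.limit_metric_sequentially by blast+
  have "(\<lambda>n. cnorm A (Y n \<ominus> l)) \<longlonglongrightarrow> 0"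
    using lim Y l cnorm_nonneg by (simp add: LIMSEQ_iff cstar_dist_def)
  with l show ?thesis by (rule that)
qed

lemma cnorm_mult_bound:
  assumes "x \<in> carrier A" "y \<in> carrier A" "cnorm A x \<le> r" "cnorm A y \<le> s"
  shows "cnorm A (x \<otimes> y) \<le> r * s"
  using cnorm_mult[of x y] mult_mono[of "cnorm A x" r "cnorm A y" s] cnorm_nonneg assms
  by fastforce

lemma square_minus_square:
  assumes "x \<in> carrier A" "y \<in> carrier A"
  shows "x \<otimes> x \<ominus> y \<otimes> y = (x \<ominus> y) \<otimes> x \<oplus> y \<otimes> (x \<ominus> y)"
  using assms by algebra

lemma cnorm_square_minus_square:
  assumes "x \<in> carrier A" "y \<in> carrier A"
  shows "cnorm A (x \<otimes> x \<ominus> y \<otimes> y) \<le> cnorm A (x \<ominus> y) * (cnorm A x + cnorm A y)"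
proof -
  have "cnorm A (x \<otimes> x \<ominus> y \<otimes> y) \<le> cnorm A ((x \<ominus> y) \<otimes> x) + cnorm A (y \<otimes> (x \<ominus> y))"
    using assms by (simp add: square_minus_square cnorm_triangle)
  also have "\<dots> \<le> cnorm A (x \<ominus> y) * cnorm A x + cnorm A y * cnorm A (x \<ominus> y)"
    using assms by (intro add_mono cnorm_mult) auto
  finally show ?thesis by (simp add: algebra_simps)
qed

lemma unital_star_hom_props:
  assumes "unital_cstar_algebra F" "unital_star_hom F A f"
  shows "\<And>x. x \<in> carrier F \<Longrightarrow> f x \<in> carrier A"
    and "\<And>x y. \<lbrakk>x \<in> carrier F; y \<in> carrier F\<rbrakk> \<Longrightarrow> f (x \<oplus>\<^bsub>F\<^esub> y) = f x \<oplus> f y"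
    and "\<And>x y. \<lbrakk>x \<in> carrier F; y \<in> carrier F\<rbrakk> \<Longrightarrow> f (x \<otimes>\<^bsub>F\<^esub> y) = f x \<otimes> f y"
    and "\<And>x c. x \<in> carrier F \<Longrightarrow> f (c \<odot>\<^bsub>F\<^esub> x) = c \<odot> f x"
    and "\<And>x. x \<in> carrier F \<Longrightarrow> f (star F x) = star A (f x)"
    and "f \<one>\<^bsub>F\<^esub> = \<one>"
    and "f \<zero>\<^bsub>F\<^esub> = \<zero>"
proof -
  interpret F: unital_cstar_algebra F by fact
  show cl: "\<And>x. x \<in> carrier F \<Longrightarrow> f x \<in> carrier A"
    and sc: "\<And>x c. x \<in> carrier F \<Longrightarrow> f (c \<odot>\<^bsub>F\<^esub> x) = c \<odot> f x"
    and "\<And>x y. \<lbrakk>x \<in> carrier F; y \<in> carrier F\<rbrakk> \<Longrightarrow> f (x \<oplus>\<^bsub>F\<^esub> y) = f x \<oplus> f y"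
    and "\<And>x y. \<lbrakk>x \<in> carrier F; y \<in> carrier F\<rbrakk> \<Longrightarrow> f (x \<otimes>\<^bsub>F\<^esub> y) = f x \<otimes> f y"
    and "\<And>x. x \<in> carrier F \<Longrightarrow> f (star F x) = star A (f x)"
    and "f \<one>\<^bsub>F\<^esub> = \<one>"
    using assms(2) unfolding unital_star_hom_def ring_hom_def by auto
  have "f (0 \<odot>\<^bsub>F\<^esub> \<one>\<^bsub>F\<^esub>) = 0 \<odot> f \<one>\<^bsub>F\<^esub>" by (rule sc) simp
  then show "f \<zero>\<^bsub>F\<^esub> = \<zero>" using cl[of "\<one>\<^bsub>F\<^esub>"] by (simp add: F.scale_0 scale_0)
qed

lemma selfadjoint_carrier: "a \<in> selfadjoint A \<Longrightarrow> a \<in> carrier A"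
  by (simp add: selfadjoint_def)

lemma selfadjoint_add: "\<lbrakk>a \<in> selfadjoint A; b \<in> selfadjoint A\<rbrakk> \<Longrightarrow> a \<oplus> b \<in> selfadjoint A"
  by (simp add: selfadjoint_def star_add)

lemma selfadjoint_scale: "a \<in> selfadjoint A \<Longrightarrow> complex_of_real t \<odot> a \<in> selfadjoint A"
  by (simp add: selfadjoint_def star_smult)

lemma selfadjoint_jordan:
  assumes "a \<in> selfadjoint A" "b \<in> selfadjoint A"
  shows "jordan_product A a b \<in> selfadjoint A"
proof -
  have "a \<in> carrier A" "b \<in> carrier A" using assms by (auto simp: selfadjoint_def)
  then have "b \<otimes> a \<oplus> a \<otimes> b = a \<otimes> b \<oplus> b \<otimes> a" by algebra
  then show ?thesis using assms
    by (simp add: selfadjoint_def jordan_product_def star_smult star_add star_mult)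
qed

lemma selfadjoint_lie:
  assumes "a \<in> selfadjoint A" "b \<in> selfadjoint A"
  shows "lie_product A a b \<in> selfadjoint A"
proof -
  have "(cnj (1 / (2 * \<i>))) \<odot> (b \<otimes> a \<ominus> a \<otimes> b) = (1 / (2 * \<i>)) \<odot> ((-1) \<odot> (b \<otimes> a \<ominus> a \<otimes> b))"
    using assms by (simp add: selfadjoint_def scale_scale)
  also have "(-1) \<odot> (b \<otimes> a \<ominus> a \<otimes> b) = a \<otimes> b \<ominus> b \<otimes> a"
  proof -
    have "\<ominus> (b \<otimes> a \<ominus> a \<otimes> b) = a \<otimes> b \<ominus> b \<otimes> a" if "a \<in> carrier A" "b \<in> carrier A"
      using that by algebra
    then show ?thesis using assms by (simp add: selfadjoint_def uminus_eq_scale)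
  qed
  finally show ?thesis using assms
    by (simp add: selfadjoint_def lie_product_def star_smult star_minus star_mult)
qed

lemma real_part_selfadjoint:
  assumes b: "b \<in> carrier A" shows "(1 / 2) \<odot> (b \<oplus> star A b) \<in> selfadjoint A"
proof -
  have "star A b \<oplus> b = b \<oplus> star A b" using b star_carrier[OF b] by algebra
  then show ?thesis using b by (simp add: selfadjoint_def star_smult star_add star_star)
qed

lemma imaginary_part_selfadjoint:
  assumes b: "b \<in> carrier A" shows "(1 / (2 * \<i>)) \<odot> (b \<ominus> star A b) \<in> selfadjoint A"
proof -
  have "star A b \<ominus> b = (-1) \<odot> (b \<ominus> star A b)"
  proof -
    have "star A b \<ominus> b = \<ominus> (b \<ominus> star A b)" using b star_carrier[OF b] by algebra
    then show ?thesis using b by (simp add: uminus_eq_scale)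
  qed
  then show ?thesis
    using b by (simp add: selfadjoint_def star_smult star_minus star_star scale_scale)
qed

lemma half_double: assumes b: "b \<in> carrier A" shows "(1 / 2) \<odot> (b \<oplus> b) = b"
proof -
  have "(1/2) \<odot> (b \<oplus> b) = (1/2 + 1/2) \<odot> b" using b by (simp only: scale_add_right scale_add_left)
  also have "(1/2 + 1/2 :: complex) = 1" by simp
  also have "1 \<odot> b = b" using b by (rule scale_1)
  finally show ?thesis .
qed

lemma real_plus_imaginary_part:
  assumes b: "b \<in> carrier A"
  shows "(1 / 2) \<odot> (b \<oplus> star A b) \<oplus> \<i> \<odot> ((1 / (2 * \<i>)) \<odot> (b \<ominus> star A b)) = b"
proof -
  have "(1 / 2) \<odot> (b \<oplus> star A b) \<oplus> \<i> \<odot> ((1 / (2 * \<i>)) \<odot> (b \<ominus> star A b))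
      = (1 / 2) \<odot> ((b \<oplus> star A b) \<oplus> (b \<ominus> star A b))"
    using b by (simp add: scale_scale scale_add_right)
  also have "(b \<oplus> star A b) \<oplus> (b \<ominus> star A b) = b \<oplus> b" using b star_carrier[OF b] by algebra
  finally show ?thesis using b by (simp only: half_double)
qed

end

lemma finsum_in_subspace:
  assumes "abelian_group G" "finite S" "\<And>s. s \<in> S \<Longrightarrow> f s \<in> V" "V \<subseteq> carrier G" "\<zero>\<^bsub>G\<^esub> \<in> V"
    and add: "\<And>u v. \<lbrakk>u \<in> V; v \<in> V\<rbrakk> \<Longrightarrow> u \<oplus>\<^bsub>G\<^esub> v \<in> V"
  shows "finsum G f S \<in> V"
proof -
  interpret abelian_group G by fact
  show ?thesis using assms(2,3)
  proof (induction S rule: finite_induct)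
    case (insert s S)
    then have "finsum G f (insert s S) = f s \<oplus>\<^bsub>G\<^esub> finsum G f S"
      using assms(4) by (intro finsum_insert) auto
    then show ?case using insert add by simp
  qed (use assms(5) in simp)
qed

section \<open>Square roots\<close>

text \<open>
  A limit \<open>y\<close> of this iteration solves \<open>2y = t + y\<^sup>2\<close>, so that \<open>1 - y\<close> is a square root of \<open>1 - t\<close>.
  Only real combinations of powers of \<open>t\<close> occur, so self-adjointness is inherited.
\<close>

primrec root_iterate :: "'a cstar \<Rightarrow> 'a \<Rightarrow> nat \<Rightarrow> 'a" where
  "root_iterate A t 0 = \<zero>\<^bsub>A\<^esub>"
| "root_iterate A t (Suc n) =
     (1 / 2) \<odot>\<^bsub>A\<^esub> (t \<oplus>\<^bsub>A\<^esub> root_iterate A t n \<otimes>\<^bsub>A\<^esub> root_iterate A t n)"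

text \<open>
  The same iteration at the worst case \<open>t = 1\<close>. It increases to \<open>1\<close>, and it dominates the iteration
  in the algebra step by step. Convergence there thus follows from that of a bounded
  monotone real sequence, also when \<open>t\<close> has norm exactly \<open>1\<close>.
\<close>

primrec scalar_root_iterate :: "nat \<Rightarrow> real" where
  "scalar_root_iterate 0 = 0"
| "scalar_root_iterate (Suc n) = (1 + (scalar_root_iterate n)\<^sup>2) / 2"

lemma scalar_root_iterate_bounds: "0 \<le> scalar_root_iterate n \<and> scalar_root_iterate n \<le> 1"
  by (induction n) (auto simp: power_le_one)

lemma scalar_root_iterate_mono: "scalar_root_iterate n \<le> scalar_root_iterate (Suc n)"
proof -
  have "0 \<le> (1 - scalar_root_iterate n)\<^sup>2" by simp
  then show ?thesis by (simp add: power2_eq_square algebra_simps)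
qed

lemma scalar_root_iterate_Cauchy: "Cauchy scalar_root_iterate"
proof -
  have "incseq scalar_root_iterate" using scalar_root_iterate_mono by (rule incseq_SucI)
  moreover have "Bseq scalar_root_iterate"
    using scalar_root_iterate_bounds by (intro BseqI'[of _ 1]) (simp add: abs_le_iff)
  ultimately have "convergent scalar_root_iterate"
    by (intro Bseq_monoseq_convergent) (auto simp: monoseq_iff)
  then show ?thesis by (rule convergent_Cauchy)
qed

context unital_cstar_algebra
begin

context
  fixes t assumes t: "t \<in> carrier A" "star A t = t" "cnorm A t \<le> 1"
begin

lemma root_iterate_closed: "root_iterate A t n \<in> carrier A"
  by (induction n) (auto simp: t)

lemma star_root_iterate: "star A (root_iterate A t n) = root_iterate A t n"
  by (induction n) (simp_all add: t star_smult star_add star_mult root_iterate_closed)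

lemma cnorm_root_iterate: "cnorm A (root_iterate A t n) \<le> scalar_root_iterate n"
proof (induction n)
  case (Suc n)
  let ?y = "root_iterate A t n"
  have "cnorm A (t \<oplus> ?y \<otimes> ?y) \<le> 1 + scalar_root_iterate n * scalar_root_iterate n"
    using cnorm_triangle[of t "?y \<otimes> ?y"] cnorm_mult_bound[of ?y ?y] Suc t root_iterate_closed[of n]
    by fastforce
  then show ?case
    using t root_iterate_closed[of n] by (simp add: cnorm_smult power2_eq_square norm_divide)
qed simp

lemma root_iterate_Suc_minus:
  "cnorm A (root_iterate A t (Suc m) \<ominus> root_iterate A t (Suc n))
     = cnorm A (root_iterate A t m \<otimes> root_iterate A t m \<ominus> root_iterate A t n \<otimes> root_iterate A t n) / 2"
proof -
  let ?y = "root_iterate A t m" and ?z = "root_iterate A t n"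
  have "(t \<oplus> ?y \<otimes> ?y) \<ominus> (t \<oplus> ?z \<otimes> ?z) = ?y \<otimes> ?y \<ominus> ?z \<otimes> ?z"
    using t root_iterate_closed by algebra
  then have "root_iterate A t (Suc m) \<ominus> root_iterate A t (Suc n) = (1/2) \<odot> (?y \<otimes> ?y \<ominus> ?z \<otimes> ?z)"
    using t root_iterate_closed by (simp add: scale_minus_right[symmetric])
  then show ?thesis using t root_iterate_closed by (simp add: cnorm_smult norm_divide)
qed

text \<open>
  The difference of two squares is \<open>(u - v) u + v (u - v)\<close>, and for the scalar iteration this is an
  equality of the form \<open>(p - q) (p + q)\<close>; so the domination propagates from one step to the next.
\<close>

lemma cnorm_root_iterate_step:
  "cnorm A (root_iterate A t (Suc n) \<ominus> root_iterate A t n)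
     \<le> scalar_root_iterate (Suc n) - scalar_root_iterate n"
proof (induction n)
  case 0
  show ?case using t by (simp add: cnorm_smult norm_divide a_minus_def)
next
  case (Suc n)
  let ?y = "root_iterate A t" and ?s = scalar_root_iterate
  have "cnorm A (?y (Suc (Suc n)) \<ominus> ?y (Suc n))
      \<le> cnorm A (?y (Suc n) \<ominus> ?y n) * (cnorm A (?y (Suc n)) + cnorm A (?y n)) / 2"
    unfolding root_iterate_Suc_minus
    by (intro divide_right_mono cnorm_square_minus_square root_iterate_closed) simp
  also have "\<dots> \<le> (?s (Suc n) - ?s n) * (?s (Suc n) + ?s n) / 2"
    using root_iterate_closed[of n] root_iterate_closed[of "Suc n"] cnorm_root_iterate[of n]
      cnorm_root_iterate[of "Suc n"] scalar_root_iterate_mono[of n] Suc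
    by (intro divide_right_mono mult_mono add_mono add_nonneg_nonneg cnorm_nonneg)
      (auto intro: order_trans[OF cnorm_nonneg] simp del: root_iterate.simps scalar_root_iterate.simps)
  also have "\<dots> = ?s (Suc (Suc n)) - ?s (Suc n)"
    by (simp add: power2_eq_square algebra_simps diff_divide_distrib add_divide_distrib)
  finally show ?case .
qed

lemma cnorm_root_iterate_diff:
  assumes "n \<le> m"
  shows "cnorm A (root_iterate A t m \<ominus> root_iterate A t n) \<le> scalar_root_iterate m - scalar_root_iterate n"
  using assms
proof (induction m rule: dec_induct)
  case base
  have "root_iterate A t n \<ominus> root_iterate A t n = \<zero>" using root_iterate_closed by algebra
  then show ?case by simp
next
  case (step m)
  then show ?case
    using cnorm_minus_triangle[of "root_iterate A t (Suc m)" "root_iterate A t m" "root_iterate A t n"]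
      root_iterate_closed cnorm_root_iterate_step[of m] 
    by (simp del: root_iterate.simps scalar_root_iterate.simps)
qed

text \<open>
  The only functional calculus that the proof needs: it turns a norm bound into positivity.
\<close>

lemma square_root_one_minus:
  obtains c where "c \<in> carrier A" "star A c = c" "c \<otimes> c = \<one> \<ominus> t"
proof -
  let ?y = "root_iterate A t" and ?s = scalar_root_iterate
  have Cauchy: "\<exists>N. \<forall>m\<ge>N. \<forall>n\<ge>N. cnorm A (?y m \<ominus> ?y n) < e" if e: "0 < e" for e
  proof -
    obtain N where N: "\<And>m n. \<lbrakk>m \<ge> N; n \<ge> N\<rbrakk> \<Longrightarrow> \<bar>?s m - ?s n\<bar> < e"
      using metric_CauchyD[OF scalar_root_iterate_Cauchy e] by (auto simp: dist_real_def)
    have "cnorm A (?y m \<ominus> ?y n) \<le> \<bar>?s m - ?s n\<bar>" for m n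
      using cnorm_root_iterate_diff[of m n] cnorm_root_iterate_diff[of n m]
        cnorm_minus_commute[OF root_iterate_closed root_iterate_closed, of m n]
      by (cases "m \<le> n") auto
    then show ?thesis using N by (meson le_less_trans)
  qed
  obtain y where y: "y \<in> carrier A" and lim: "(\<lambda>n. cnorm A (?y n \<ominus> y)) \<longlonglongrightarrow> 0"
    using Cauchy_imp_norm_convergent[OF root_iterate_closed Cauchy] by blast
  have small: "\<exists>n. cnorm A (?y n \<ominus> y) < e \<and> cnorm A (?y (Suc n) \<ominus> y) < e" if "0 < e" for e
  proof -
    have "eventually (\<lambda>n. cnorm A (?y n \<ominus> y) < e) sequentially"
      using order_tendstoD(2)[OF lim that] .
    then show ?thesis unfolding eventually_sequentially by (meson le_SucI order_refl)
  qed
  have star_y: "star A y = y"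
  proof (rule eq_if_norm_minus_small)
    fix e :: real assume "0 < e"
    then obtain n where n: "cnorm A (?y n \<ominus> y) < e / 2" using small[of "e/2"] by auto
    have "cnorm A (star A y \<ominus> ?y n) = cnorm A (star A (y \<ominus> ?y n))"
      using y root_iterate_closed by (simp add: star_minus star_root_iterate)
    also have "\<dots> = cnorm A (?y n \<ominus> y)"
      using y root_iterate_closed by (simp add: cnorm_star cnorm_minus_commute)
    finally show "cnorm A (star A y \<ominus> y) \<le> e"
      using cnorm_minus_triangle[of "star A y" "?y n" y] n y root_iterate_closed[of n] by simp
  qed (use y in auto)
  have fixpoint: "(1/2) \<odot> (t \<oplus> y \<otimes> y) = y"
  proof (rule eq_if_norm_minus_small)
    fix e :: real assume "0 < e"
    \<comment> \<open>The two errors below add up to at most \<open>d * (cnorm A y + 1) + d = e\<close>.\<close>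
    define d where "d = e / (2 + cnorm A y)"
    have d: "0 < d" using \<open>0 < e\<close> cnorm_nonneg[OF y] by (simp add: d_def)
    then obtain n where n: "cnorm A (?y n \<ominus> y) < d" "cnorm A (?y (Suc n) \<ominus> y) < d"
      using small by blast
    have "(t \<oplus> y \<otimes> y) \<ominus> (t \<oplus> ?y n \<otimes> ?y n) = y \<otimes> y \<ominus> ?y n \<otimes> ?y n"
      using t y root_iterate_closed by algebra
    then have "(1/2) \<odot> (t \<oplus> y \<otimes> y) \<ominus> ?y (Suc n) = (1/2) \<odot> (y \<otimes> y \<ominus> ?y n \<otimes> ?y n)"
      using t y root_iterate_closed by (simp add: scale_minus_right[symmetric])
    then have "cnorm A ((1/2) \<odot> (t \<oplus> y \<otimes> y) \<ominus> ?y (Suc n)) = cnorm A (y \<otimes> y \<ominus> ?y n \<otimes> ?y n) / 2"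
      using t y root_iterate_closed by (simp add: cnorm_smult norm_divide)
    also have "\<dots> \<le> cnorm A (?y n \<ominus> y) * (cnorm A y + cnorm A (?y n)) / 2"
      using cnorm_square_minus_square[of y "?y n"] y root_iterate_closed[of n]
        cnorm_minus_commute[of y "?y n"] by simp
    also have "\<dots> \<le> d * (cnorm A y + 1) / 2"
      using n d y cnorm_root_iterate[of n] scalar_root_iterate_bounds[of n] root_iterate_closed[of n]
      by (intro divide_right_mono mult_mono add_mono add_nonneg_nonneg cnorm_nonneg)
        (auto intro: less_imp_le)
    also have "\<dots> \<le> d * (cnorm A y + 1)"
      using d cnorm_nonneg[OF y] by simp
    finally have "cnorm A ((1/2) \<odot> (t \<oplus> y \<otimes> y) \<ominus> y) \<le> d * (cnorm A y + 1) + d"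
      using cnorm_minus_triangle[of "(1/2) \<odot> (t \<oplus> y \<otimes> y)" "?y (Suc n)" y] n t y
        root_iterate_closed[of n] root_iterate_closed[of "Suc n"]
      by (simp del: root_iterate.simps)
    also have "\<dots> = d * (2 + cnorm A y)" by (simp add: algebra_simps)
    also have "\<dots> = e" using cnorm_nonneg[OF y] by (simp add: d_def)
    finally show "cnorm A ((1/2) \<odot> (t \<oplus> y \<otimes> y) \<ominus> y) \<le> e" .
  qed (use t y in auto)
  \<comment> \<open>The fixed point equation says \<open>t + y\<^sup>2 = 2y\<close>, that is, \<open>(1 - y)\<^sup>2 = 1 - t\<close>.\<close>
  have "2 \<odot> ((1/2) \<odot> (t \<oplus> y \<otimes> y)) = 2 \<odot> y" by (simp only: fixpoint)
  then have "t \<oplus> y \<otimes> y = 2 \<odot> y" using t y by (simp add: scale_scale scale_1)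
  also have "\<dots> = y \<oplus> y" using y scale_add_left[of y 1 1] by (simp add: scale_1)
  finally have ty: "t \<oplus> y \<otimes> y = y \<oplus> y" .
  have "(\<one> \<ominus> y) \<otimes> (\<one> \<ominus> y) = \<one> \<ominus> (y \<oplus> y \<otimes> \<one>) \<oplus> y \<otimes> y"
    using y by algebra
  also have "y \<otimes> \<one> = y" using y by simp
  also have "\<one> \<ominus> (y \<oplus> y) \<oplus> y \<otimes> y = \<one> \<ominus> (t \<oplus> y \<otimes> y) \<oplus> y \<otimes> y" by (simp only: ty)
  also have "\<dots> = \<one> \<ominus> t" using t y by algebra
  finally show ?thesis using that[of "\<one> \<ominus> y"] y star_y by (simp add: star_minus)
qed

end

end

section \<open>States\<close>

context unital_cstar_algebra
begin

lemma state_add: "\<lbrakk>\<phi> \<in> state_space A; x \<in> carrier A; y \<in> carrier A\<rbrakk> \<Longrightarrow> \<phi> (x \<oplus> y) = \<phi> x + \<phi> y"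
  and state_scale: "\<lbrakk>\<phi> \<in> state_space A; x \<in> carrier A\<rbrakk> \<Longrightarrow> \<phi> (c \<odot> x) = c * \<phi> x"
  and state_bound: "\<lbrakk>\<phi> \<in> state_space A; x \<in> carrier A\<rbrakk> \<Longrightarrow> cmod (\<phi> x) \<le> cnorm A x"
  and state_one: "\<phi> \<in> state_space A \<Longrightarrow> \<phi> \<one> = 1"
  by (auto simp: state_space_def is_state_def)

lemma state_minus:
  "\<lbrakk>\<phi> \<in> state_space A; x \<in> carrier A; y \<in> carrier A\<rbrakk> \<Longrightarrow> \<phi> (x \<ominus> y) = \<phi> x - \<phi> y"
  by (simp add: minus_eq_scale state_add state_scale)

lemma state_zero: "\<phi> \<in> state_space A \<Longrightarrow> \<phi> \<zero> = 0"
  using state_scale[of \<phi> \<zero> 0] by (simp add: scale_0)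

lemma state_diff_le:
  assumes "\<phi> \<in> state_space A" "\<psi> \<in> state_space A" "a \<in> carrier A" "b \<in> carrier A"
  shows "cmod (\<phi> a - \<psi> a) \<le> 2 * cnorm A (a \<ominus> b) + cmod (\<phi> b - \<psi> b)"
proof -
  have "\<phi> a - \<psi> a = (\<phi> (a \<ominus> b) - \<psi> (a \<ominus> b)) + (\<phi> b - \<psi> b)"
    using assms by (simp add: state_minus)
  also have "cmod \<dots> \<le> cmod (\<phi> (a \<ominus> b)) + cmod (\<psi> (a \<ominus> b)) + cmod (\<phi> b - \<psi> b)"
    by (meson add_right_mono norm_triangle_ineq norm_triangle_ineq4 order_trans)
  finally show ?thesis using state_bound[of \<phi> "a \<ominus> b"] state_bound[of \<psi> "a \<ominus> b"] assms by simp
qed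

lemma continuous_map_weak_star:
  assumes "set us \<subseteq> carrier A"
  shows "continuous_map (weak_star_topology A) euclideanreal
    (\<lambda>\<psi>. \<Sum>u\<leftarrow>us. c u * cmod (\<phi> u - \<psi> u))"
  using assms
proof (induction us)
  case (Cons u us)
  have "continuous_map (weak_star_topology A) euclidean (\<lambda>\<psi>. \<psi> u)"
    unfolding weak_star_topology_def
    using Cons.prems by (intro continuous_map_from_subtopology continuous_map_product_projection) auto
  then have "continuous_map (weak_star_topology A) euclideanreal (\<lambda>\<psi>. c u * cmod (\<phi> u - \<psi> u))"
    by (intro continuous_map_real_mult continuous_map_norm continuous_map_diff) auto
  then show ?case using Cons by (auto intro!: continuous_map_add)
qed simp

end

section \<open>The inner product of a faithful trace\<close>

text \<open>
  Used to remove multiplicative constants: a bound for all powers \<open>2 ^ k\<close> with a constant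
  independent of \<open>k\<close> gives the bound with constant \<open>1\<close>.
\<close>

lemma le_if_powers_le:
  fixes r s C :: real
  assumes "0 \<le> r" "0 \<le> s" and le: "\<And>k. r ^ 2 ^ k \<le> C * s ^ 2 ^ k"
  shows "r \<le> s"
proof (rule ccontr)
  assume "\<not> r \<le> s"
  show False
  proof (cases "s = 0")
    case True then show False using le[of 0] \<open>\<not> r \<le> s\<close> by simp
  next
    case False
    then have s: "0 < s" using assms by simp
    then have "1 < r / s" using \<open>\<not> r \<le> s\<close> by simp
    then obtain n where "C < (r / s) ^ n" using real_arch_pow by blast
    also have "\<dots> \<le> (r / s) ^ 2 ^ n"
      using \<open>1 < r / s\<close> by (intro power_increasing) (auto simp: less_imp_le)
    also have "\<dots> \<le> C" using le[of n] s by (simp add: power_divide divide_le_eq)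
    finally show False by simp
  qed
qed

locale tracial_cstar_algebra = unital_cstar_algebra A for A :: "'a cstar" (structure) +
  fixes \<mu> :: "'a \<Rightarrow> complex"
  assumes faithful_trace: "faithful_tracial_state A \<mu>"
begin

lemma mu_add: "\<lbrakk>x \<in> carrier A; y \<in> carrier A\<rbrakk> \<Longrightarrow> \<mu> (x \<oplus> y) = \<mu> x + \<mu> y"
  and mu_scale: "x \<in> carrier A \<Longrightarrow> \<mu> (c \<odot> x) = c * \<mu> x"
  and mu_one: "\<mu> \<one> = 1"
  and mu_bound: "x \<in> carrier A \<Longrightarrow> cmod (\<mu> x) \<le> cnorm A x"
  and mu_commute: "\<lbrakk>x \<in> carrier A; y \<in> carrier A\<rbrakk> \<Longrightarrow> \<mu> (x \<otimes> y) = \<mu> (y \<otimes> x)"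
  using faithful_trace unfolding faithful_tracial_state_def is_state_def by auto

lemma mu_positive:
  "x \<in> carrier A \<Longrightarrow> \<mu> (star A x \<otimes> x) \<in> \<real> \<and> 0 \<le> Re (\<mu> (star A x \<otimes> x))"
  using faithful_trace unfolding faithful_tracial_state_def is_state_def cstar_positive_def
  by blast

lemma mu_faithful: "\<lbrakk>x \<in> carrier A; \<mu> (star A x \<otimes> x) = 0\<rbrakk> \<Longrightarrow> x = \<zero>"
  using faithful_trace unfolding faithful_tracial_state_def by blast

text \<open>
  Positivity makes the trace real on \<open>(x + c)\<^sup>* (x + c)\<close> for every scalar \<open>c\<close>; the cases \<open>c = 1\<close>
  and \<open>c = \<i>\<close> give the imaginary and the real part of the claim.
\<close>

lemma mu_star: assumes x: "x \<in> carrier A" shows "\<mu> (star A x) = cnj (\<mu> x)"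
proof -
  have "Im (c * \<mu> (star A x) + cnj c * \<mu> x) = 0" for c
  proof -
    let ?y = "x \<oplus> c \<odot> \<one>"
    have "\<mu> (star A ?y \<otimes> ?y) = \<mu> (star A x \<otimes> x) + c * \<mu> (star A x) + cnj c * \<mu> x + cnj c * c"
      using x by (simp add: star_add star_smult mult_distrib_left mult_distrib_right smult_mult_left smult_mult_right
        mu_add mu_scale scale_add_right mu_one)
    then show ?thesis
      using mu_positive[of ?y] mu_positive[OF x] x by (simp add: complex_is_Real_iff)
  qed
  from this[of 1] this[of \<i>] show ?thesis by (simp add: complex_eq_iff)
qed

text \<open>
  The inner product and norm of the Hilbert space on which the algebra is represented by
  its trace. The inner product is linear in its second argument.
\<close>

definition ip :: "'a \<Rightarrow> 'a \<Rightarrow> complex" where "ip x y = \<mu> (star A x \<otimes> y)"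

definition l2norm :: "'a \<Rightarrow> real" where "l2norm x = sqrt (Re (ip x x))"

lemma ip_add_right: "\<lbrakk>x \<in> carrier A; y \<in> carrier A; z \<in> carrier A\<rbrakk> \<Longrightarrow> ip x (y \<oplus> z) = ip x y + ip x z"
  by (simp add: ip_def mult_distrib_left mu_add)

lemma ip_add_left: "\<lbrakk>x \<in> carrier A; y \<in> carrier A; z \<in> carrier A\<rbrakk> \<Longrightarrow> ip (x \<oplus> y) z = ip x z + ip y z"
  by (simp add: ip_def mult_distrib_right mu_add star_add)

lemma ip_scale_right: "\<lbrakk>x \<in> carrier A; y \<in> carrier A\<rbrakk> \<Longrightarrow> ip x (c \<odot> y) = c * ip x y"
  by (simp add: ip_def smult_mult_right mu_scale)

lemma ip_scale_left: "\<lbrakk>x \<in> carrier A; y \<in> carrier A\<rbrakk> \<Longrightarrow> ip (c \<odot> x) y = cnj c * ip x y"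
  by (simp add: ip_def smult_mult_left star_smult mu_scale)

lemma ip_minus_right: "\<lbrakk>x \<in> carrier A; y \<in> carrier A; z \<in> carrier A\<rbrakk> \<Longrightarrow> ip x (y \<ominus> z) = ip x y - ip x z"
  by (simp add: minus_eq_scale ip_add_right ip_scale_right)

lemma ip_minus_left: "\<lbrakk>x \<in> carrier A; y \<in> carrier A; z \<in> carrier A\<rbrakk> \<Longrightarrow> ip (x \<ominus> y) z = ip x z - ip y z"
  by (simp add: minus_eq_scale ip_add_left ip_scale_left)

lemmas ip_linear = ip_add_right ip_add_left ip_scale_right ip_scale_left ip_minus_right ip_minus_left

lemma cnj_ip: assumes "x \<in> carrier A" "y \<in> carrier A" shows "cnj (ip x y) = ip y x"
proof -
  have "star A (star A x \<otimes> y) = star A y \<otimes> x" using assms by (simp add: star_mult star_star)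
  then show ?thesis using mu_star[of "star A x \<otimes> y"] assms by (simp add: ip_def)
qed

lemma ip_mult_left: "\<lbrakk>a \<in> carrier A; x \<in> carrier A; y \<in> carrier A\<rbrakk> \<Longrightarrow> ip (a \<otimes> x) y = ip x (star A a \<otimes> y)"
  by (simp add: ip_def star_mult mult_assoc)

text \<open>
  By traciality right multiplication has an adjoint too; the bimodule property of the projection
  rests on this.
\<close>

lemma ip_mult_right:
  assumes "a \<in> carrier A" "x \<in> carrier A" "y \<in> carrier A"
  shows "ip (x \<otimes> a) y = ip x (y \<otimes> star A a)"
  using mu_commute[of "star A a" "star A x \<otimes> y"] assms by (simp add: ip_def star_mult mult_assoc)

lemma l2norm_nonneg [simp]: "x \<in> carrier A \<Longrightarrow> 0 \<le> l2norm x"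
  using mu_positive[of x] by (simp add: l2norm_def ip_def)

lemma ip_self: "x \<in> carrier A \<Longrightarrow> ip x x = complex_of_real ((l2norm x)\<^sup>2)"
  using mu_positive[of x] by (simp add: l2norm_def ip_def complex_eq_iff complex_is_Real_iff)

lemma l2norm_eq_zero: "\<lbrakk>x \<in> carrier A; l2norm x = 0\<rbrakk> \<Longrightarrow> x = \<zero>"
  using ip_self[of x] mu_faithful[of x] by (simp add: ip_def)

lemma l2norm_le_cnorm: assumes x: "x \<in> carrier A" shows "l2norm x \<le> cnorm A x"
proof -
  have "(l2norm x)\<^sup>2 = cmod (ip x x)" using x by (simp add: ip_self norm_power)
  also have "\<dots> \<le> (cnorm A x)\<^sup>2"
    using mu_bound[of "star A x \<otimes> x"] cnorm_star_mult[OF x] x by (simp add: ip_def)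
  finally show ?thesis using cnorm_nonneg[OF x] power2_le_imp_le by blast
qed

lemma ip_zero_right [simp]: "x \<in> carrier A \<Longrightarrow> ip x \<zero> = 0"
  using ip_scale_right[of x \<zero> 0] by (simp add: scale_0)

lemma ip_Cauchy_Schwarz:
  assumes x: "x \<in> carrier A" and y: "y \<in> carrier A"
  shows "cmod (ip x y) \<le> l2norm x * l2norm y"
proof (cases "l2norm y = 0")
  case True
  then show ?thesis using l2norm_eq_zero[OF y] x by simp
next
  case False
  define N where "N = (l2norm y)\<^sup>2"
  \<comment> \<open>The residual of \<open>x\<close> after projection to the line of \<open>y\<close>.\<close>
  define z where "z = x \<ominus> (ip y x / N) \<odot> y"
  have N: "0 < N" using False by (simp add: N_def)
  have z: "z \<in> carrier A" using x y by (simp add: z_def)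
  have "ip z z = ip x x - ip y x * cnj (ip y x) / N"
    using x y N by (simp add: z_def ip_linear cnj_ip ip_self[OF y] N_def[symmetric] field_simps)
  also have "\<dots> = complex_of_real ((l2norm x)\<^sup>2 - (cmod (ip y x))\<^sup>2 / N)"
    by (simp add: ip_self[OF x] complex_norm_square[symmetric])
  finally have "(l2norm z)\<^sup>2 = (l2norm x)\<^sup>2 - (cmod (ip y x))\<^sup>2 / N"
    using ip_self[OF z] of_real_eq_iff by metis
  then have "(cmod (ip y x))\<^sup>2 / N \<le> (l2norm x)\<^sup>2"
    using zero_le_power2[of "l2norm z"] by linarith
  then have "(cmod (ip y x))\<^sup>2 \<le> (l2norm x * l2norm y)\<^sup>2"
    using N by (simp add: divide_le_eq power_mult_distrib N_def)
  moreover have "cmod (ip x y) = cmod (ip y x)" using cnj_ip[OF y x] complex_mod_cnj by metis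
  ultimately show ?thesis using power2_le_imp_le x y by simp
qed

lemma iterated_square_closed: "h \<in> carrier A \<Longrightarrow> ((\<lambda>y. y \<otimes> y) ^^ k) h \<in> carrier A"
  by (induction k) auto

lemma iterated_square_selfadjoint:
  "\<lbrakk>h \<in> carrier A; star A h = h\<rbrakk> \<Longrightarrow> star A (((\<lambda>y. y \<otimes> y) ^^ k) h) = ((\<lambda>y. y \<otimes> y) ^^ k) h"
  by (induction k) (auto simp: star_mult iterated_square_closed)

lemma cnorm_iterated_square:
  assumes "h \<in> carrier A" "star A h = h"
  shows "cnorm A (((\<lambda>y. y \<otimes> y) ^^ k) h) = cnorm A h ^ 2 ^ k"
  by (induction k)
    (simp_all add: assms iterated_square_closed iterated_square_selfadjoint
      cnorm_selfadjoint_square power_mult[symmetric] mult.commute)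

lemma l2norm_square_mult_le:
  assumes "x \<in> carrier A" "b \<in> carrier A"
  shows "(l2norm (x \<otimes> b))\<^sup>2 \<le> l2norm b * l2norm (star A x \<otimes> x \<otimes> b)"
proof -
  have "complex_of_real ((l2norm (x \<otimes> b))\<^sup>2) = ip b (star A x \<otimes> x \<otimes> b)"
    using assms by (simp add: ip_self[symmetric] ip_mult_left mult_assoc del: of_real_power)
  then have "(l2norm (x \<otimes> b))\<^sup>2 = cmod (ip b (star A x \<otimes> x \<otimes> b))"
    by (metis norm_of_real abs_of_nonneg zero_le_power2)
  then show ?thesis using assms ip_Cauchy_Schwarz[of b "star A x \<otimes> x \<otimes> b"] by simp
qed

text \<open>
  Iterating the Cauchy--Schwarz inequality bounds the power \<open>2 ^ k\<close> of \<open>\<parallel>hb\<parallel> / \<parallel>b\<parallel>\<close> by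
  \<open>\<parallel>h ^ (2 ^ k) b\<parallel> / \<parallel>b\<parallel>\<close> in the trace norm, hence by a constant times the power \<open>2 ^ k\<close> of the
  C*-norm of \<open>h\<close>. The constant disappears in the limit.
\<close>

lemma l2norm_selfadjoint_mult:
  assumes h: "h \<in> carrier A" "star A h = h" and b: "b \<in> carrier A"
  shows "l2norm (h \<otimes> b) \<le> cnorm A h * l2norm b"
proof (cases "l2norm b = 0")
  case True
  then have "b = \<zero>" using b l2norm_eq_zero by blast
  then show ?thesis using h True by (simp add: l2norm_def)
next
  case False
  define N where "N = l2norm b"
  have N: "0 < N" using False l2norm_nonneg[OF b] unfolding N_def by linarith
  let ?P = "\<lambda>k. ((\<lambda>y. y \<otimes> y) ^^ k) h"
  have P: "?P k \<in> carrier A" "star A (?P k) = ?P k" for k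
    using h by (simp_all add: iterated_square_closed iterated_square_selfadjoint)
  have step: "(l2norm (h \<otimes> b) / N) ^ 2 ^ k \<le> l2norm (?P k \<otimes> b) / N" for k
  proof (induction k)
    case (Suc k)
    have "(l2norm (h \<otimes> b) / N) ^ 2 ^ Suc k = ((l2norm (h \<otimes> b) / N) ^ 2 ^ k)\<^sup>2"
      by (simp add: power_mult[symmetric] mult.commute)
    also have "\<dots> \<le> (l2norm (?P k \<otimes> b) / N)\<^sup>2"
      using Suc N h b by (intro power_mono zero_le_power) auto
    also have "\<dots> = (l2norm (?P k \<otimes> b))\<^sup>2 / (N * N)" by (simp add: power2_eq_square)
    also have "\<dots> \<le> N * l2norm (?P (Suc k) \<otimes> b) / (N * N)"
      using l2norm_square_mult_le[OF P(1)[of k] b] N P(2)[of k]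
      by (intro divide_right_mono) (simp_all add: N_def)
    finally show ?case using N by simp
  qed simp
  have "(l2norm (h \<otimes> b) / N) ^ 2 ^ k \<le> (cnorm A b / N) * cnorm A h ^ 2 ^ k" for k
  proof -
    have "l2norm (?P k \<otimes> b) \<le> cnorm A (?P k \<otimes> b)" using P[of k] b by (simp add: l2norm_le_cnorm)
    also have "\<dots> \<le> cnorm A b * cnorm A h ^ 2 ^ k"
      using cnorm_mult[OF P(1)[of k] b] h by (simp add: cnorm_iterated_square mult.commute)
    finally have "l2norm (?P k \<otimes> b) / N \<le> cnorm A b * cnorm A h ^ 2 ^ k / N"
      using N by (intro divide_right_mono) auto
    then show ?thesis using step[of k] by simp
  qed
  then have "l2norm (h \<otimes> b) / N \<le> cnorm A h"
    by (rule le_if_powers_le[rotated 2]) (use h b N cnorm_nonneg in auto)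
  then show ?thesis using N by (simp add: N_def field_simps)
qed

text \<open>
  Left multiplication is a contractive representation. The general case follows from the
  self-adjoint one by the C*-identity.
\<close>

lemma l2norm_mult:
  assumes x: "x \<in> carrier A" and b: "b \<in> carrier A"
  shows "l2norm (x \<otimes> b) \<le> cnorm A x * l2norm b"
proof -
  have "(l2norm (x \<otimes> b))\<^sup>2 \<le> l2norm b * l2norm (star A x \<otimes> x \<otimes> b)"
    using x b by (rule l2norm_square_mult_le)
  also have "\<dots> \<le> l2norm b * (cnorm A (star A x \<otimes> x) * l2norm b)"
    using x b by (intro mult_left_mono l2norm_selfadjoint_mult) (auto simp: star_mult star_star)
  also have "\<dots> = (cnorm A x * l2norm b)\<^sup>2"
    using x by (simp add: cnorm_star_mult power2_eq_square)
  finally show ?thesis using x b cnorm_nonneg by (auto intro: power2_le_imp_le)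
qed

lemma state_space_nonempty: "state_space A \<noteq> {}"
proof -
  have pos: "cstar_positive A \<subseteq> carrier A" by (auto simp: cstar_positive_def)
  have "is_state A \<mu>" using faithful_trace by (simp add: faithful_tracial_state_def)
  then have "restrict \<mu> (carrier A) \<in> state_space A"
    using pos unfolding state_space_def is_state_def by (simp add: subset_iff)
  then show ?thesis by blast
qed

end

section \<open>Frames\<close>

context tracial_cstar_algebra
begin

text \<open>
  The frame operator of a finite list of vectors, the sum of all \<open>ip e x \<odot> e\<close>. If it fixes a
  subspace pointwise and the vectors lie in this subspace, then it is the orthogonal projection onto
  it. Recursion over a list reduces its properties to inductions, without finite sums in
  an algebra with a carrier.
\<close>

primrec frame_op :: "'a list \<Rightarrow> 'a \<Rightarrow> 'a" where
  "frame_op [] x = \<zero>"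
| "frame_op (e # es) x = frame_op es x \<oplus> ip e x \<odot> e"

lemma frame_op_closed [simp, intro]:
  "\<lbrakk>set es \<subseteq> carrier A; x \<in> carrier A\<rbrakk> \<Longrightarrow> frame_op es x \<in> carrier A"
  by (induction es) auto

lemma frame_op_add:
  assumes "set es \<subseteq> carrier A" "x \<in> carrier A" "y \<in> carrier A"
  shows "frame_op es (x \<oplus> y) = frame_op es x \<oplus> frame_op es y"
  using assms
proof (induction es)
  case (Cons e es)
  have "frame_op es x \<oplus> frame_op es y \<oplus> (ip e x \<odot> e \<oplus> ip e y \<odot> e)
      = frame_op es x \<oplus> ip e x \<odot> e \<oplus> (frame_op es y \<oplus> ip e y \<odot> e)"
    using Cons.prems by (intro add_interchange) auto
  then show ?case using Cons by (simp add: ip_add_right scale_add_left)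
qed simp

lemma frame_op_scale:
  assumes "set es \<subseteq> carrier A" "x \<in> carrier A"
  shows "frame_op es (c \<odot> x) = c \<odot> frame_op es x"
  using assms
  by (induction es) (simp_all add: scale_zero ip_scale_right scale_add_right scale_scale)

lemma frame_op_minus:
  assumes "set es \<subseteq> carrier A" "x \<in> carrier A" "y \<in> carrier A"
  shows "frame_op es (x \<ominus> y) = frame_op es x \<ominus> frame_op es y"
  using assms by (simp add: minus_eq_scale frame_op_add frame_op_scale)

lemma ip_frame_op:
  assumes "set es \<subseteq> carrier A" "x \<in> carrier A" "y \<in> carrier A"
  shows "ip (frame_op es x) y = ip x (frame_op es y)"
  using assms
proof (induction es)
  case Nil
  then show ?case using cnj_ip[of y \<zero>] by simp
next
  case (Cons e es)
  then show ?case by (simp add: ip_linear cnj_ip)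
qed

lemma frame_op_in_subspace:
  assumes "set es \<subseteq> V" "V \<subseteq> carrier A" "\<zero> \<in> V"
    and "\<And>x y. \<lbrakk>x \<in> V; y \<in> V\<rbrakk> \<Longrightarrow> x \<oplus> y \<in> V" and "\<And>c x. x \<in> V \<Longrightarrow> c \<odot> x \<in> V"
  shows "frame_op es x \<in> V"
  using assms(1) by (induction es) (auto simp: assms(3-))

lemma cnorm_frame_op:
  assumes "set es \<subseteq> carrier A" "x \<in> carrier A"
  shows "cnorm A (frame_op es x) \<le> (\<Sum>e\<leftarrow>es. l2norm e * cnorm A e) * l2norm x"
  using assms
proof (induction es)
  case (Cons e es)
  have "cnorm A (frame_op (e # es) x) \<le> cnorm A (frame_op es x) + cmod (ip e x) * cnorm A e"
    using Cons.prems cnorm_triangle[of "frame_op es x" "ip e x \<odot> e"] by (simp add: cnorm_smult)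
  also have "\<dots> \<le> (\<Sum>e\<leftarrow>es. l2norm e * cnorm A e) * l2norm x + (l2norm e * l2norm x) * cnorm A e"
    using Cons by (intro add_mono mult_right_mono ip_Cauchy_Schwarz cnorm_nonneg) auto
  finally show ?case by (simp add: algebra_simps)
qed simp

text \<open>
  Gram--Schmidt, with the reproducing property in place of orthonormality: if a new
  vector \<open>s\<close> is not yet reproduced, the normalized residual of \<open>s\<close> is added to the list.
\<close>

lemma ex_frame:
  assumes S: "finite S" "S \<subseteq> V" and V: "V \<subseteq> carrier A" "\<zero> \<in> V"
    and add: "\<And>x y. \<lbrakk>x \<in> V; y \<in> V\<rbrakk> \<Longrightarrow> x \<oplus> y \<in> V" and scale: "\<And>c x. x \<in> V \<Longrightarrow> c \<odot> x \<in> V"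
  shows "\<exists>es. set es \<subseteq> V \<and> (\<forall>x\<in>S \<union> set es. frame_op es x = x)"
  using S
proof (induction S rule: finite_induct)
  case empty
  then show ?case by (intro exI[of _ "[]"]) auto
next
  case (insert s S)
  then obtain es where es: "set es \<subseteq> V" and fixed: "\<And>x. x \<in> S \<union> set es \<Longrightarrow> frame_op es x = x"
    by auto
  let ?P = "frame_op es"
  have esA: "set es \<subseteq> carrier A" and s: "s \<in> carrier A" "s \<in> V" and SA: "S \<subseteq> carrier A"
    using es insert.prems V by auto
  define r where "r = s \<ominus> ?P s"
  have Ps: "?P s \<in> V" using es V add scale by (rule frame_op_in_subspace)
  have rV: "r \<in> V" unfolding r_def using s Ps V add scale minus_eq_scale[of s "?P s"] by auto
  have r: "r \<in> carrier A" using rV V by auto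
  have PPs: "?P (?P s) = ?P s"
  proof -
    have "?P s \<in> {x \<in> carrier A. ?P x = x}"
      by (rule frame_op_in_subspace)
        (use esA fixed frame_op_scale[OF esA, of \<zero> 0] in
          \<open>auto simp: frame_op_add frame_op_scale scale_0\<close>)
    then show ?thesis by simp
  qed
  have Pr: "?P r = \<zero>"
  proof -
    have "?P r = ?P s \<ominus> ?P s" using s esA by (simp add: r_def frame_op_minus PPs)
    also have "\<dots> = \<zero>" using frame_op_closed[OF esA s(1)] by algebra
    finally show ?thesis .
  qed
  \<comment> \<open>The old frame operator is symmetric and annihilates \<open>r\<close>, so the new vector is orthogonal
    to everything that was already reproduced.\<close>
  have orth: "ip r x = 0" if "x \<in> carrier A" "?P x = x" for x
    using ip_frame_op[OF esA r that(1)] cnj_ip[of x \<zero>] that by (simp add: Pr)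
  show ?case
  proof (cases "r = \<zero>")
    case True
    then have "?P s = s"
      using s esA cnorm_minus_eq_zero[of s "?P s"] by (simp add: r_def)
    then show ?thesis using es fixed by (intro exI[of _ es]) auto
  next
    case False
    define N where "N = l2norm r"
    have N: "0 < N" using False l2norm_eq_zero[OF r] l2norm_nonneg[OF r] unfolding N_def by force
    define u where "u = complex_of_real (1 / N) \<odot> r"
    have u: "u \<in> V" "u \<in> carrier A" using rV r scale by (auto simp: u_def)
    have ip_u: "ip u x = ip r x / N" if "x \<in> carrier A" for x
      using that r by (simp add: u_def ip_scale_left)
    have "frame_op (u # es) x = x" if "x \<in> S \<union> set es" for x
    proof -
      have "x \<in> carrier A" "?P x = x" using that fixed SA esA by auto
      then show ?thesis using orth u by (simp add: ip_u scale_0)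
    qed
    moreover have "frame_op (u # es) s = s"
    proof -
      have "ip r s = ip r (r \<oplus> ?P s)"
      proof -
        have "s = r \<oplus> ?P s" using s esA frame_op_closed[OF esA s(1)] unfolding r_def by algebra
        then show ?thesis by simp
      qed
      then have "ip r s = N\<^sup>2" using r s esA orth[of "?P s"] by (simp add: ip_linear PPs ip_self N_def)
      then have "ip u s = complex_of_real N" using s N by (simp add: ip_u power2_eq_square)
      then have "ip u s \<odot> u = r" using r N by (simp add: u_def scale_scale scale_1)
      moreover have "?P s \<oplus> r = s" using s frame_op_closed[OF esA s(1)] unfolding r_def by algebra
      ultimately show ?thesis by simp
    qed
    moreover have "frame_op (u # es) u = u"
    proof -
      have "?P u = \<zero>" using r esA by (simp add: u_def frame_op_scale Pr scale_zero)
      moreover have "ip u u = 1"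
        using r N ip_u[OF u(2)] by (simp add: u_def ip_scale_right ip_self flip: N_def) (simp add: power2_eq_square)
      ultimately show ?thesis using u by (simp add: scale_1)
    qed
    ultimately show ?thesis using es u by (intro exI[of _ "u # es"]) auto
  qed
qed

text \<open>
  Turns smallness at finitely many vectors, which is a weak* condition, into smallness on a
  bounded subset of a finite-dimensional space.
\<close>

lemma state_diff_frame_op:
  assumes "\<phi> \<in> state_space A" "\<psi> \<in> state_space A" "set us \<subseteq> carrier A" "x \<in> carrier A"
  shows "cmod (\<phi> (frame_op us x) - \<psi> (frame_op us x))
    \<le> l2norm x * (\<Sum>u\<leftarrow>us. l2norm u * cmod (\<phi> u - \<psi> u))"
  using assms(3)
proof (induction us)
  case (Cons u us)
  have "\<phi> (frame_op (u # us) x) - \<psi> (frame_op (u # us) x)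
      = (\<phi> (frame_op us x) - \<psi> (frame_op us x)) + ip u x * (\<phi> u - \<psi> u)"
    using Cons.prems assms by (simp add: state_add state_scale algebra_simps)
  also have "cmod \<dots> \<le> cmod (\<phi> (frame_op us x) - \<psi> (frame_op us x)) + cmod (ip u x) * cmod (\<phi> u - \<psi> u)"
    by (metis norm_triangle_ineq norm_mult)
  also have "\<dots> \<le> l2norm x * (\<Sum>u\<leftarrow>us. l2norm u * cmod (\<phi> u - \<psi> u))
      + (l2norm u * l2norm x) * cmod (\<phi> u - \<psi> u)"
    using Cons assms by (intro add_mono mult_right_mono ip_Cauchy_Schwarz) auto
  finally show ?case by (simp add: algebra_simps)
qed (use assms in \<open>simp add: state_zero\<close>)

end

section \<open>The trace-preserving conditional expectation\<close>

text \<open>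
  A unital *-subalgebra \<open>B\<close> with a finite frame, that is, a finite-dimensional one. Carrying the
  frame along gives the projection onto \<open>B\<close>, its continuity, and coordinates by one formula.
\<close>

locale framed_star_subalgebra = tracial_cstar_algebra A \<mu>
  for A :: "'a cstar" (structure) and \<mu> +
  fixes B :: "'a set" and es :: "'a list"
  assumes B_subset: "B \<subseteq> carrier A"
    and one_in_B: "\<one> \<in> B"
    and B_add: "\<lbrakk>x \<in> B; y \<in> B\<rbrakk> \<Longrightarrow> x \<oplus> y \<in> B"
    and B_mult: "\<lbrakk>x \<in> B; y \<in> B\<rbrakk> \<Longrightarrow> x \<otimes> y \<in> B"
    and B_scale: "x \<in> B \<Longrightarrow> c \<odot> x \<in> B"
    and B_star: "x \<in> B \<Longrightarrow> star A x \<in> B"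
    and es_subset: "set es \<subseteq> B"
    and frame_op_id: "b \<in> B \<Longrightarrow> frame_op es b = b"
begin

lemma B_carrier [simp, intro]: "b \<in> B \<Longrightarrow> b \<in> carrier A"
  using B_subset by auto

lemma es_carrier: "set es \<subseteq> carrier A"
  using es_subset B_subset by auto

lemma zero_in_B: "\<zero> \<in> B"
  using B_scale[OF one_in_B, of 0] by (simp add: scale_0)

lemma B_minus: "\<lbrakk>x \<in> B; y \<in> B\<rbrakk> \<Longrightarrow> x \<ominus> y \<in> B"
  by (simp add: minus_eq_scale B_add B_scale)

abbreviation E where "E \<equiv> frame_op es"

lemma E_carrier [simp, intro]: "x \<in> carrier A \<Longrightarrow> E x \<in> carrier A"
  using es_carrier by auto

lemma E_in_B: "x \<in> carrier A \<Longrightarrow> E x \<in> B"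
  using es_subset B_subset zero_in_B B_add B_scale by (rule frame_op_in_subspace)

lemma ip_E: "\<lbrakk>b \<in> B; x \<in> carrier A\<rbrakk> \<Longrightarrow> ip b (E x) = ip b x"
  using ip_frame_op[OF es_carrier, of b x] by (simp add: frame_op_id)

text \<open>
  Faithfulness: an element of \<open>B\<close> is determined by its inner products with \<open>B\<close>. All
  algebraic properties of the projection are derived from this.
\<close>

lemma E_unique:
  assumes e: "e \<in> B" and x: "x \<in> carrier A" and ip: "\<And>b. b \<in> B \<Longrightarrow> ip b e = ip b x"
  shows "E x = e"
proof -
  have d: "E x \<ominus> e \<in> B" using e x E_in_B by (intro B_minus)
  have "ip (E x \<ominus> e) (E x \<ominus> e) = 0"
    using ip[OF d] ip_E[OF d x] d e x by (subst ip_minus_right) auto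
  then have "E x \<ominus> e = \<zero>" using mu_faithful[of "E x \<ominus> e"] e x by (simp add: ip_def)
  then show ?thesis using e x cnorm_minus_eq_zero[of "E x" e] by simp
qed

lemma mu_E: "x \<in> carrier A \<Longrightarrow> \<mu> (E x) = \<mu> x"
  using ip_E[OF one_in_B, of x] by (simp add: ip_def)

lemma E_bimodule:
  assumes x: "x \<in> carrier A" and b: "b \<in> B" and c: "c \<in> B"
  shows "E (b \<otimes> x \<otimes> c) = b \<otimes> E x \<otimes> c"
proof (rule E_unique)
  fix d assume d: "d \<in> B"
  have *: "ip d (b \<otimes> y \<otimes> c) = ip (star A b \<otimes> d \<otimes> star A c) y" if y: "y \<in> carrier A" for y
    using b c d y ip_mult_right[of "star A c" "star A b \<otimes> d" y] ip_mult_left[of "star A b" d "y \<otimes> c"]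
    by (simp add: star_star mult_assoc)
  show "ip d (b \<otimes> E x \<otimes> c) = ip d (b \<otimes> x \<otimes> c)"
    using x b c d by (simp add: * ip_E B_mult B_star)
qed (use x b c in \<open>auto intro!: B_mult E_in_B\<close>)

lemma E_mult_right: "\<lbrakk>x \<in> carrier A; b \<in> B\<rbrakk> \<Longrightarrow> E (x \<otimes> b) = E x \<otimes> b"
  using E_bimodule[OF _ one_in_B, of x b] by simp

lemma E_star:
  assumes x: "x \<in> carrier A" shows "E (star A x) = star A (E x)"
proof (rule E_unique)
  fix b assume b: "b \<in> B"
  have *: "ip b (star A y) = cnj (ip (star A b) y)" if y: "y \<in> carrier A" for y
    using mu_star[of "b \<otimes> y"] mu_commute[of "star A y" "star A b"] b y
    by (simp add: ip_def star_star star_mult)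
  show "ip b (star A (E x)) = ip b (star A x)"
    using x b by (simp add: * ip_E B_star)
qed (use x in \<open>auto intro!: B_star E_in_B\<close>)

lemma l2norm_E_le:
  assumes x: "x \<in> carrier A" shows "l2norm (E x) \<le> l2norm x"
proof -
  have "complex_of_real ((l2norm (E x))\<^sup>2) = ip (E x) x"
    using ip_E[OF E_in_B[OF x] x] x by (simp add: ip_self)
  then have "(l2norm (E x))\<^sup>2 = cmod (ip (E x) x)"
    by (metis norm_of_real abs_of_nonneg zero_le_power2)
  also have "\<dots> \<le> l2norm (E x) * l2norm x" using x by (simp add: ip_Cauchy_Schwarz)
  finally show ?thesis
    using x by (cases "l2norm (E x) = 0") (simp_all add: power2_eq_square, metis l2norm_nonneg E_carrier le_less mult_le_cancel_left_pos)
qed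

text \<open>
  The C*-norm on \<open>B\<close> is recovered from the action on the trace Hilbert space. On the
  finite-dimensional \<open>B\<close> the C*-norm is at most a constant times the trace norm; applying this to
  iterated squares, whose norms are powers of the norm of \<open>h\<close>, removes the constant.
\<close>

lemma cnorm_selfadjoint_le_if_l2_bounded:
  assumes h: "h \<in> B" "star A h = h" and M: "0 \<le> M"
    and bound: "\<And>b. b \<in> B \<Longrightarrow> l2norm (h \<otimes> b) \<le> M * l2norm b"
  shows "cnorm A h \<le> M"
proof -
  let ?P = "\<lambda>k. ((\<lambda>y. y \<otimes> y) ^^ k) h"
  define C where "C = (\<Sum>e\<leftarrow>es. l2norm e * cnorm A e)"
  have C: "0 \<le> C" unfolding C_def
    using es_carrier by (intro sum_list_nonneg) (auto intro!: mult_nonneg_nonneg cnorm_nonneg)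
  have P: "?P k \<in> B" for k using h by (induction k) (auto intro: B_mult)
  have l2: "l2norm (?P k \<otimes> b) \<le> M ^ 2 ^ k * l2norm b" if "b \<in> B" for k b
    using that
  proof (induction k arbitrary: b)
    case (Suc k)
    have "l2norm (?P (Suc k) \<otimes> b) = l2norm (?P k \<otimes> (?P k \<otimes> b))"
      using P[of k] Suc.prems by (simp add: mult_assoc)
    also have "\<dots> \<le> M ^ 2 ^ k * (M ^ 2 ^ k * l2norm b)"
      using Suc.IH[of "?P k \<otimes> b"] Suc.IH[of b] Suc.prems P[of k] M
      by (meson B_mult mult_left_mono order_trans zero_le_power)
    also have "\<dots> = M ^ 2 ^ Suc k * l2norm b" by (simp add: power_add mult_2)
    finally show ?case .
  qed (use bound in simp)
  have "cnorm A h ^ 2 ^ k \<le> C * M ^ 2 ^ k" for k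
  proof -
    have "cnorm A h ^ 2 ^ k = cnorm A (E (?P k))"
      using h P by (simp add: cnorm_iterated_square frame_op_id)
    also have "\<dots> \<le> C * l2norm (?P k)"
      unfolding C_def using P es_carrier by (intro cnorm_frame_op) auto
    also have "l2norm (?P k) \<le> M ^ 2 ^ k"
      using l2[OF one_in_B, of k] P[of k] by (simp add: l2norm_def ip_def mu_one)
    finally show ?thesis using C by (simp add: mult_left_mono)
  qed
  then show ?thesis
    by (rule le_if_powers_le[rotated 2]) (use h M in \<open>auto intro: cnorm_nonneg\<close>)
qed

lemma cnorm_le_if_l2_bounded:
  assumes e: "e \<in> B" and M: "0 \<le> M"
    and bound: "\<And>b. b \<in> B \<Longrightarrow> l2norm (e \<otimes> b) \<le> M * l2norm b"
  shows "cnorm A e \<le> M"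
proof -
  have star_bound: "l2norm (star A e \<otimes> b) \<le> M * l2norm b" if b: "b \<in> B" for b
  proof (cases "l2norm (star A e \<otimes> b) = 0")
    case False
    have "(l2norm (star A e \<otimes> b))\<^sup>2 \<le> l2norm b * l2norm (e \<otimes> (star A e \<otimes> b))"
      using l2norm_square_mult_le[of "star A e" b] e b by (simp add: star_star mult_assoc)
    also have "\<dots> \<le> l2norm b * (M * l2norm (star A e \<otimes> b))"
      using bound[of "star A e \<otimes> b"] e b by (intro mult_left_mono) (auto intro: B_mult B_star)
    finally have "l2norm (star A e \<otimes> b) * l2norm (star A e \<otimes> b) \<le> M * l2norm b * l2norm (star A e \<otimes> b)"
      by (simp add: power2_eq_square mult_ac)
    moreover have "0 < l2norm (star A e \<otimes> b)"
      using False l2norm_nonneg[of "star A e \<otimes> b"] e b by (simp add: less_le)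
    ultimately show ?thesis by (rule mult_right_le_imp_le)
  qed (use b M in simp)
  have "cnorm A (star A e \<otimes> e) \<le> M * M"
  proof (rule cnorm_selfadjoint_le_if_l2_bounded)
    fix b assume b: "b \<in> B"
    have "l2norm (star A e \<otimes> (e \<otimes> b)) \<le> M * (M * l2norm b)"
      using star_bound[of "e \<otimes> b"] bound[OF b] M b e by (meson B_mult mult_left_mono order_trans)
    then show "l2norm (star A e \<otimes> e \<otimes> b) \<le> M * M * l2norm b"
      using e b by (simp add: mult_assoc)
  qed (use e M in \<open>auto simp: star_mult star_star intro: B_mult B_star\<close>)
  then have "(cnorm A e)\<^sup>2 \<le> M\<^sup>2" using e by (simp add: cnorm_star_mult power2_eq_square)
  then show ?thesis using M power2_le_imp_le by blast
qed

text \<open>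
  Left multiplication by the projection of \<open>x\<close> is the compression to \<open>B\<close> of left multiplication by
  \<open>x\<close>, by the module property. So a bound for the latter is a bound for the former.
\<close>

lemma cnorm_E_le_if_l2_bounded:
  assumes x: "x \<in> carrier A" and M: "0 \<le> M"
    and bound: "\<And>b. b \<in> B \<Longrightarrow> l2norm (x \<otimes> b) \<le> M * l2norm b"
  shows "cnorm A (E x) \<le> M"
proof (rule cnorm_le_if_l2_bounded)
  fix b assume b: "b \<in> B"
  have "l2norm (E x \<otimes> b) = l2norm (E (x \<otimes> b))" using x b by (simp add: E_mult_right)
  also have "\<dots> \<le> l2norm (x \<otimes> b)" using x b by (intro l2norm_E_le) auto
  finally show "l2norm (E x \<otimes> b) \<le> M * l2norm b" using bound[OF b] by simp
qed (use x M in \<open>auto intro: E_in_B\<close>)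

lemma cnorm_E_le: "x \<in> carrier A \<Longrightarrow> cnorm A (E x) \<le> cnorm A x"
  by (rule cnorm_E_le_if_l2_bounded) (auto intro: cnorm_nonneg l2norm_mult)

text \<open>
  With \<open>M = \<parallel>x\<parallel>\<^sup>2\<close>, left multiplication by \<open>1 - x\<^sup>* x / M\<close> is a contraction, hence so is the projection
  of this element, and one minus that projection has a square root. The result is the projection
  of \<open>x\<^sup>* x\<close> up to the factor \<open>M\<close>.
\<close>

lemma E_positive:
  assumes x: "x \<in> carrier A" shows "E (star A x \<otimes> x) \<in> cstar_positive A"
proof (cases "x = \<zero>")
  case True
  have "E (star A x \<otimes> x) = star A \<zero> \<otimes> \<zero>" using frame_op_id[OF zero_in_B] True by simp
  then show ?thesis unfolding cstar_positive_def by blast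
next
  case False
  define M where "M = (cnorm A x)\<^sup>2"
  have M: "0 < M" using False cnorm_eq_zero[OF x] by (simp add: M_def)
  define p where "p = star A x \<otimes> x"
  define z where "z = \<one> \<ominus> complex_of_real (1 / M) \<odot> p"
  have p: "p \<in> carrier A" "star A p = p" using x by (simp_all add: p_def star_mult star_star)
  have z: "z \<in> carrier A" using p by (simp add: z_def)
  have "l2norm (z \<otimes> b) \<le> l2norm b" if b: "b \<in> B" for b
  proof -
    have bA: "b \<in> carrier A" using b by simp
    have zb: "z \<otimes> b = b \<ominus> complex_of_real (1 / M) \<odot> (p \<otimes> b)"
      using bA p by (simp add: z_def minus_eq_scale mult_distrib_right scale_scale smult_mult_left)
    have ipb: "ip b (p \<otimes> b) = (l2norm (x \<otimes> b))\<^sup>2" "ip (p \<otimes> b) b = (l2norm (x \<otimes> b))\<^sup>2"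
      using x bA by (simp_all add: p_def ip_self[symmetric] ip_mult_left star_mult star_star mult_assoc del: of_real_power)
    have "complex_of_real ((l2norm (z \<otimes> b))\<^sup>2)
        = (l2norm b)\<^sup>2 - 2 / M * (l2norm (x \<otimes> b))\<^sup>2 + (l2norm (p \<otimes> b))\<^sup>2 / (M * M)"
      using bA p z unfolding zb
      by (simp add: ip_self[symmetric] ip_linear del: of_real_power of_real_diff of_real_add of_real_divide of_real_mult)
        (simp add: ip_self ipb algebra_simps)
    then have eq: "(l2norm (z \<otimes> b))\<^sup>2
        = (l2norm b)\<^sup>2 - 2 / M * (l2norm (x \<otimes> b))\<^sup>2 + (l2norm (p \<otimes> b))\<^sup>2 / (M * M)"
      using of_real_eq_iff by blast
    have "l2norm (p \<otimes> b) \<le> cnorm A x * l2norm (x \<otimes> b)"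
      using l2norm_mult[of "star A x" "x \<otimes> b"] x bA by (simp add: p_def mult_assoc cnorm_star)
    then have "(l2norm (p \<otimes> b))\<^sup>2 \<le> M * (l2norm (x \<otimes> b))\<^sup>2"
      using power_mono[of "l2norm (p \<otimes> b)" "cnorm A x * l2norm (x \<otimes> b)" 2] p bA
      by (simp add: M_def power_mult_distrib)
    then have "(l2norm (p \<otimes> b))\<^sup>2 / (M * M) \<le> (l2norm (x \<otimes> b))\<^sup>2 / M"
      using M by (simp add: divide_le_eq mult.commute)
    moreover have "0 \<le> (l2norm (x \<otimes> b))\<^sup>2 / M" using M by simp
    ultimately have "(l2norm (z \<otimes> b))\<^sup>2 \<le> (l2norm b)\<^sup>2" using eq by simp
    then show ?thesis using power2_le_imp_le l2norm_nonneg[OF bA] by blast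
  qed
  then have "cnorm A (E z) \<le> 1" using z by (intro cnorm_E_le_if_l2_bounded) auto
  moreover have "star A (E z) = E z"
    using p z by (simp add: E_star[symmetric]) (simp add: z_def star_minus star_smult)
  ultimately obtain c where c: "c \<in> carrier A" "star A c = c" "c \<otimes> c = \<one> \<ominus> E z"
    using z by (meson square_root_one_minus E_carrier)
  have "E z = \<one> \<ominus> complex_of_real (1 / M) \<odot> E p"
    using p es_carrier by (simp add: z_def frame_op_minus frame_op_scale frame_op_id[OF one_in_B])
  then have "c \<otimes> c = complex_of_real (1 / M) \<odot> E p"
    using c p one_minus_one_minus[of "complex_of_real (1 / M) \<odot> E p"] by simp
  then have "E p = complex_of_real M \<odot> (c \<otimes> c)"
    using p M by (simp add: scale_scale scale_1 flip: of_real_mult)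
  also have "\<dots> = star A (complex_of_real (sqrt M) \<odot> c) \<otimes> (complex_of_real (sqrt M) \<odot> c)"
    using c M z by (simp add: star_smult smult_mult_left smult_mult_right scale_scale flip: of_real_mult)
  finally show ?thesis using c unfolding cstar_positive_def p_def by blast
qed

theorem conditional_expectation_E: "conditional_expectation A B (restrict E (carrier A))"
  unfolding conditional_expectation_def
proof (intro conjI ballI allI)
  show "restrict E (carrier A) \<in> carrier A \<rightarrow> B" using E_in_B by auto
next
  fix x y assume "x \<in> carrier A" "y \<in> carrier A"
  then show "restrict E (carrier A) (x \<oplus> y) = restrict E (carrier A) x \<oplus> restrict E (carrier A) y"
    using es_carrier by (simp add: frame_op_add)
next
  fix c x assume "x \<in> carrier A"
  then show "restrict E (carrier A) (c \<odot> x) = c \<odot> restrict E (carrier A) x"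
    using es_carrier by (simp add: frame_op_scale)
next
  fix x assume "x \<in> cstar_positive A"
  then obtain y where y: "y \<in> carrier A" "x = star A y \<otimes> y" unfolding cstar_positive_def by blast
  then show "restrict E (carrier A) x \<in> cstar_positive A" using E_positive[OF y(1)] by simp
next
  fix x assume "x \<in> carrier A"
  then show "cnorm A (restrict E (carrier A) x) \<le> cnorm A x" by (simp add: cnorm_E_le)
next
  fix b assume "b \<in> B"
  then show "restrict E (carrier A) b = b" by (simp add: frame_op_id)
next
  fix x b c assume "x \<in> carrier A" "b \<in> B" "c \<in> B"
  then show "restrict E (carrier A) (b \<otimes> x \<otimes> c) = b \<otimes> restrict E (carrier A) x \<otimes> c"
    by (simp add: E_bimodule)
qed

text \<open>
  Uniqueness is what the definite description needs: a trace-preserving bimodule map has the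
  inner products with \<open>B\<close> that characterize the projection.
\<close>

theorem cond_exp_onto_eq: "cond_exp_onto A \<mu> B = restrict E (carrier A)"
  unfolding cond_exp_onto_def
proof (rule the_equality)
  show "restrict E (carrier A) \<in> extensional (carrier A)
      \<and> conditional_expectation A B (restrict E (carrier A))
      \<and> (\<forall>x\<in>carrier A. \<mu> (restrict E (carrier A) x) = \<mu> x)"
    using conditional_expectation_E by (simp add: mu_E)
next
  fix G assume G: "G \<in> extensional (carrier A) \<and> conditional_expectation A B G
      \<and> (\<forall>x\<in>carrier A. \<mu> (G x) = \<mu> x)"
  then have GB: "\<And>x. x \<in> carrier A \<Longrightarrow> G x \<in> B" and mu_G: "\<And>x. x \<in> carrier A \<Longrightarrow> \<mu> (G x) = \<mu> x"
    and bimod: "\<And>x b c. \<lbrakk>x \<in> carrier A; b \<in> B; c \<in> B\<rbrakk> \<Longrightarrow> G (b \<otimes> x \<otimes> c) = b \<otimes> G x \<otimes> c"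
    unfolding conditional_expectation_def by auto
  have "G x = E x" if x: "x \<in> carrier A" for x
  proof (rule E_unique[symmetric])
    fix b assume b: "b \<in> B"
    have "G (star A b \<otimes> x) = star A b \<otimes> G x"
      using bimod[OF x B_star[OF b] one_in_B] x b GB[OF x] by simp
    then show "ip b (G x) = ip b x" using mu_G[of "star A b \<otimes> x"] x b by (simp add: ip_def)
  qed (use x GB in auto)
  then show "G = restrict E (carrier A)"
    using G by (intro extensionalityI[of _ "carrier A"]) auto
qed

end

text \<open>
  A frame of the span of the images of a spanning set does it: the elements whose image it
  reproduces form a subspace that contains the spanning set.
\<close>

lemma (in tracial_cstar_algebra) image_framed_star_subalgebra:
  assumes F: "unital_cstar_algebra F" and fd: "finite_dimensional F" and f: "unital_star_hom F A f"
  shows "\<exists>es. framed_star_subalgebra A \<mu> (f ` carrier F) es"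
proof -
  interpret F: unital_cstar_algebra F by fact
  note hom = unital_star_hom_props[OF F f]
  let ?B = "f ` carrier F"
  have add: "x \<oplus> y \<in> ?B" if "x \<in> ?B" "y \<in> ?B" for x y
    using that by (auto simp: hom(2)[symmetric])
  have mult: "x \<otimes> y \<in> ?B" if "x \<in> ?B" "y \<in> ?B" for x y
    using that by (auto simp: hom(3)[symmetric])
  have scale: "c \<odot> x \<in> ?B" if "x \<in> ?B" for c x
    using that by (auto simp: hom(4)[symmetric])
  have star: "star A x \<in> ?B" if "x \<in> ?B" for x
    using that by (auto simp: hom(5)[symmetric])
  have one: "\<one> \<in> ?B" using F.one_closed hom(6) by (metis image_eqI)
  have zero: "\<zero> \<in> ?B" using F.zero_closed hom(7) by (metis image_eqI)
  have B: "?B \<subseteq> carrier A" using hom(1) by auto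
  obtain S where S: "finite S" "S \<subseteq> carrier F"
    and span: "\<And>x. x \<in> carrier F \<Longrightarrow> \<exists>c. x = (\<Oplus>\<^bsub>F\<^esub>s\<in>S. c s \<odot>\<^bsub>F\<^esub> s)"
    using fd unfolding finite_dimensional_def by auto
  have "\<exists>es. set es \<subseteq> ?B \<and> (\<forall>x\<in>f ` S \<union> set es. frame_op es x = x)"
    by (rule ex_frame) (use S B zero add scale in auto)
  then obtain es where es: "set es \<subseteq> ?B" "\<And>s. s \<in> S \<Longrightarrow> frame_op es (f s) = f s" by auto
  have esA: "set es \<subseteq> carrier A" using es(1) B by auto
  have "frame_op es (f x) = f x" if x: "x \<in> carrier F" for x
  proof -
    let ?V = "{x \<in> carrier F. frame_op es (f x) = f x}"
    obtain c where c: "x = (\<Oplus>\<^bsub>F\<^esub>s\<in>S. c s \<odot>\<^bsub>F\<^esub> s)" using span[OF x] by blast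
    have "x \<in> ?V" unfolding c
    proof (rule finsum_in_subspace)
      show "abelian_group F" by (rule F.abelian_group_axioms)
      show "\<zero>\<^bsub>F\<^esub> \<in> ?V" using frame_op_scale[OF esA, of \<zero> 0] esA by (simp add: hom(7) scale_0)
      show "c s \<odot>\<^bsub>F\<^esub> s \<in> ?V" if "s \<in> S" for s
      proof -
        have "s \<in> carrier F" using that S(2) by auto
        then show ?thesis using es(2)[OF that] esA by (simp add: hom(1,4) frame_op_scale)
      qed
      show "u \<oplus>\<^bsub>F\<^esub> v \<in> ?V" if "u \<in> ?V" "v \<in> ?V" for u v
        using that esA by (simp add: hom(1,2) frame_op_add)
      show "finite S" by (rule S(1))
      show "?V \<subseteq> carrier F" by blast
    qed
    then show ?thesis by simp
  qed
  then have fixed: "frame_op es b = b" if "b \<in> ?B" for b using that by blast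
  have "framed_star_subalgebra A \<mu> ?B es"
    by (intro framed_star_subalgebra.intro framed_star_subalgebra_axioms.intro tracial_cstar_algebra_axioms)
      (fact B one add mult scale star es(1) fixed)+
  then show ?thesis by (rule exI)
qed

section \<open>Towers of finite-dimensional subalgebras\<close>

text \<open>
  What remains of the inductive limit: an increasing sequence of finite-dimensional unital
  *-subalgebras with dense union that starts with the scalars.
\<close>

locale af_tower = tracial_cstar_algebra A \<mu>
  for A :: "'a cstar" (structure) and \<mu> +
  fixes B :: "nat \<Rightarrow> 'a set" and es :: "nat \<Rightarrow> 'a list"
  assumes framed: "framed_star_subalgebra A \<mu> (B n) (es n)"
    and B_mono: "m \<le> n \<Longrightarrow> B m \<subseteq> B n"
    and B_0: "B 0 = range (\<lambda>c. c \<odot> \<one>)"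
    and B_dense: "\<lbrakk>a \<in> carrier A; 0 < e\<rbrakk> \<Longrightarrow> \<exists>n. \<exists>b\<in>B n. cnorm A (a \<ominus> b) < e"

sublocale af_tower \<subseteq> T: framed_star_subalgebra A \<mu> "B n" "es n" for n
  by (rule framed)

context af_tower
begin

abbreviation E :: "nat \<Rightarrow> 'a \<Rightarrow> 'a" where "E n \<equiv> frame_op (es n)"

text \<open>
  The seminorms whose weighted supremum is the Lip-norm.
\<close>

definition dev :: "nat \<Rightarrow> 'a \<Rightarrow> real" where "dev n a = cnorm A (a \<ominus> E n a)"

lemma E_closed [simp, intro]: "a \<in> carrier A \<Longrightarrow> E n a \<in> carrier A"
  by (rule T.E_carrier)

lemma B_closed [simp, intro]: "b \<in> B n \<Longrightarrow> b \<in> carrier A"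
  by (rule T.B_carrier)

lemma E_add: "\<lbrakk>a \<in> carrier A; b \<in> carrier A\<rbrakk> \<Longrightarrow> E n (a \<oplus> b) = E n a \<oplus> E n b"
  using T.es_carrier by (rule frame_op_add)

lemma E_scale: "a \<in> carrier A \<Longrightarrow> E n (c \<odot> a) = c \<odot> E n a"
  using T.es_carrier by (rule frame_op_scale)

lemma E_minus: "\<lbrakk>a \<in> carrier A; b \<in> carrier A\<rbrakk> \<Longrightarrow> E n (a \<ominus> b) = E n a \<ominus> E n b"
  using T.es_carrier by (rule frame_op_minus)

lemma E_id: "b \<in> B n \<Longrightarrow> E n b = b"
  by (rule T.frame_op_id)

lemma E_0_scalar: "a \<in> carrier A \<Longrightarrow> \<exists>c. E 0 a = c \<odot> \<one>"
  using T.E_in_B[of a 0] B_0 by auto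

text \<open>
  The tower property, from the characterization of \<open>E m a\<close> by inner products.
\<close>

lemma E_E:
  assumes "m \<le> n" and a: "a \<in> carrier A" shows "E m (E n a) = E m a"
proof (rule T.E_unique)
  fix b assume b: "b \<in> B m"
  then have "b \<in> B n" using B_mono[OF assms(1)] by auto
  then show "ip b (E m a) = ip b (E n a)" using a b by (simp add: T.ip_E)
qed (use a in \<open>auto intro: T.E_in_B\<close>)

lemma dev_nonneg [simp]: "a \<in> carrier A \<Longrightarrow> 0 \<le> dev n a"
  by (simp add: dev_def cnorm_nonneg)

lemma dev_scale: "a \<in> carrier A \<Longrightarrow> dev n (c \<odot> a) = cmod c * dev n a"
  by (simp add: dev_def E_scale cnorm_smult flip: scale_minus_right)

lemma dev_add:
  assumes "a \<in> carrier A" "b \<in> carrier A"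
  shows "dev n (a \<oplus> b) \<le> dev n a + dev n b"
proof -
  have "(a \<oplus> b) \<ominus> (E n a \<oplus> E n b) = (a \<ominus> E n a) \<oplus> (b \<ominus> E n b)"
    using assms E_closed[of a n] E_closed[of b n] by algebra
  then show ?thesis
    using assms cnorm_triangle[of "a \<ominus> E n a" "b \<ominus> E n b"] by (simp add: dev_def E_add)
qed

lemma dev_minus:
  assumes "a \<in> carrier A" "b \<in> carrier A"
  shows "dev n (a \<ominus> b) \<le> dev n a + dev n b"
  using dev_add[of a "(-1) \<odot> b" n] assms by (simp add: minus_eq_scale dev_scale)

lemma dev_in_B: "b \<in> B n \<Longrightarrow> dev n b = 0"
  using cnorm_minus_eq_zero[of b b] by (auto simp: dev_def E_id)

lemma dev_le: "a \<in> carrier A \<Longrightarrow> dev n a \<le> 2 * cnorm A a"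
  using cnorm_minus_le[of a "E n a"] T.cnorm_E_le[of a n] by (simp add: dev_def)

text \<open>
  Put \<open>p = E n a \<otimes> E n b\<close>. Since \<open>p\<close> is fixed by \<open>E n\<close>, the product may be replaced by
  \<open>a \<otimes> b \<ominus> p\<close>, whose norm is bounded by the usual two-term estimate. Discarding the
  expectation costs the factor \<open>2\<close>, which is the first constant of the quasi-Leibniz property.
\<close>

lemma dev_mult:
  assumes a: "a \<in> carrier A" and b: "b \<in> carrier A"
  shows "dev n (a \<otimes> b) \<le> 2 * (cnorm A a * dev n b + cnorm A b * dev n a)"
proof -
  define p where "p = E n a \<otimes> E n b"
  have p: "p \<in> B n" unfolding p_def using a b by (intro T.B_mult T.E_in_B)
  define d where "d = a \<otimes> b \<ominus> p"
  have d: "d \<in> carrier A" using p a b by (simp add: d_def)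
  have "a \<otimes> b \<ominus> E n (a \<otimes> b) = d \<ominus> E n d"
  proof -
    have "E n d = E n (a \<otimes> b) \<ominus> p" using a b p by (simp add: d_def E_minus E_id)
    moreover have "a \<otimes> b \<ominus> E n (a \<otimes> b) = (a \<otimes> b \<ominus> p) \<ominus> (E n (a \<otimes> b) \<ominus> p)"
      using a b p B_closed[OF p] E_closed[of "a \<otimes> b" n] by algebra
    ultimately show ?thesis by (simp add: d_def)
  qed
  then have "dev n (a \<otimes> b) = dev n d" by (simp add: dev_def)
  also have "\<dots> \<le> 2 * cnorm A d" using d by (rule dev_le)
  also have "d = a \<otimes> (b \<ominus> E n b) \<oplus> (a \<ominus> E n a) \<otimes> E n b"
    unfolding d_def p_def using a b E_closed[of a n] E_closed[of b n] by algebra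
  also have "cnorm A \<dots> \<le> cnorm A (a \<otimes> (b \<ominus> E n b)) + cnorm A ((a \<ominus> E n a) \<otimes> E n b)"
    using a b by (intro cnorm_triangle) auto
  also have "cnorm A (a \<otimes> (b \<ominus> E n b)) \<le> cnorm A a * dev n b"
    unfolding dev_def using a b by (intro cnorm_mult) auto
  also have "cnorm A ((a \<ominus> E n a) \<otimes> E n b) \<le> dev n a * cnorm A b"
    unfolding dev_def using a b by (intro cnorm_mult_bound T.cnorm_E_le) auto
  finally show ?thesis by (simp add: mult.commute)
qed

lemma dev_jordan:
  assumes a: "a \<in> carrier A" and b: "b \<in> carrier A"
  shows "dev n (jordan_product A a b) \<le> 2 * (cnorm A a * dev n b + cnorm A b * dev n a)"
  using dev_add[of "a \<otimes> b" "b \<otimes> a" n] dev_mult[OF a b, of n] dev_mult[OF b a, of n] a b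
  by (simp add: jordan_product_def dev_scale norm_divide)

lemma dev_lie:
  assumes a: "a \<in> carrier A" and b: "b \<in> carrier A"
  shows "dev n (lie_product A a b) \<le> 2 * (cnorm A a * dev n b + cnorm A b * dev n a)"
  using dev_minus[of "a \<otimes> b" "b \<otimes> a" n] dev_mult[OF a b, of n] dev_mult[OF b a, of n] a b
  by (simp add: lie_product_def dev_scale norm_divide norm_mult)

lemma dev_diff_le:
  assumes "a \<in> carrier A" "b \<in> carrier A"
  shows "dev n a \<le> dev n b + 2 * cnorm A (a \<ominus> b)"
proof -
  have "a = b \<oplus> (a \<ominus> b)" using assms by algebra
  then have "dev n a \<le> dev n b + dev n (a \<ominus> b)" using dev_add[of b "a \<ominus> b" n] assms by simp
  then show ?thesis using dev_le[of "a \<ominus> b" n] assms by simp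
qed

lemma selfadjoint_E: "a \<in> selfadjoint A \<Longrightarrow> E n a \<in> selfadjoint A"
  using T.E_star[of a n] by (simp add: selfadjoint_def)

definition L :: "(nat \<Rightarrow> real) \<Rightarrow> 'a \<Rightarrow> ennreal" where
  "L y a = (if a \<in> selfadjoint A then (SUP n. ennreal (dev n a / y n)) else \<infinity>)"

text \<open>
  Reduces statements about the extended-valued Lip-norm to real inequalities.
\<close>

lemma L_le_iff:
  assumes y: "\<forall>n. 0 < y n" and r: "0 \<le> r"
  shows "L y a \<le> ennreal r \<longleftrightarrow> a \<in> selfadjoint A \<and> (\<forall>n. dev n a \<le> r * y n)"
  using y r by (auto simp: L_def SUP_le_iff ennreal_le_iff divide_le_eq top_unique)

lemma L_finite:
  assumes "L y a < \<infinity>"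
  obtains r where "0 \<le> r" "L y a = ennreal r" "a \<in> selfadjoint A"
  using assms by (cases "L y a") (auto simp: L_def split: if_splits)

definition lip_ball :: "(nat \<Rightarrow> real) \<Rightarrow> 'a set" where
  "lip_ball y = {a \<in> selfadjoint A. \<forall>n. dev n a \<le> y n}"

lemma lip_ball_carrier: "a \<in> lip_ball y \<Longrightarrow> a \<in> carrier A"
  and lip_ball_dev: "a \<in> lip_ball y \<Longrightarrow> dev n a \<le> y n"
  by (auto simp: lip_ball_def selfadjoint_carrier)

lemma lip_ball_eq:
  assumes "\<forall>n. 0 < y n"
  shows "{a \<in> selfadjoint A. L y a \<le> 1} = lip_ball y" "{a \<in> dom_lip (L y). L y a \<le> 1} = lip_ball y"
proof -
  have *: "L y a \<le> 1 \<longleftrightarrow> a \<in> lip_ball y" for a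
    using L_le_iff[OF assms, where r = 1 and a = a] by (simp add: lip_ball_def)
  show "{a \<in> selfadjoint A. L y a \<le> 1} = lip_ball y" unfolding * by (auto simp: lip_ball_def)
  have "L y a < \<infinity>" if "L y a \<le> 1" for a using that le_less_trans[of "L y a" 1 \<infinity>] by simp
  then show "{a \<in> dom_lip (L y). L y a \<le> 1} = lip_ball y" using * by (auto simp: dom_lip_def)
qed

text \<open>
  On a finite stage only finitely many of the seminorms are nonzero, so its self-adjoint
  elements have finite Lip-norm.
\<close>

lemma scaled_in_lip_ball:
  assumes y: "\<forall>n. 0 < y n" and h: "h \<in> B n" "h \<in> selfadjoint A"
  shows "\<exists>t>0. complex_of_real t \<odot> h \<in> lip_ball y"
proof -
  \<comment> \<open>The element \<open>1\<close> keeps the set nonempty for \<open>n = 0\<close>.\<close>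
  define m where "m = Min (insert 1 (y ` {..<n}))"
  have m: "0 < m" unfolding m_def using y by (subst Min_gr_iff) auto
  have my: "m \<le> y k" if "k < n" for k unfolding m_def using that by (intro Min_le) auto
  have hn: "0 \<le> cnorm A h" using h by (simp add: cnorm_nonneg)
  define t where "t = m / (2 * cnorm A h + 1)"
  have t: "0 < t" using m hn by (simp add: t_def)
  have "t * dev k h \<le> y k" for k
  proof (cases "k < n")
    case True
    have "t * dev k h \<le> t * (2 * cnorm A h + 1)"
      using dev_le[of h k] h t by (intro mult_left_mono) auto
    also have "\<dots> = m" using hn by (simp add: t_def)
    finally show ?thesis using my[OF True] by simp
  next
    case False
    then have "h \<in> B k" using h B_mono[of n k] by auto
    then show ?thesis using y[rule_format, of k] by (simp add: dev_in_B less_imp_le)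
  qed
  then show ?thesis using t h by (intro exI[of _ t]) (simp add: lip_ball_def selfadjoint_scale dev_scale)
qed

end

section \<open>The Monge--Kantorovich metric\<close>

locale af_lip = af_tower A \<mu> B es
  for A :: "'a cstar" (structure) and \<mu> B es +
  fixes y :: "nat \<Rightarrow> real"
  assumes y: "\<forall>n. 0 < y n" and y_lim: "y \<longlonglongrightarrow> 0"
begin

abbreviation mk where "mk \<equiv> (\<lambda>\<phi> \<psi>. enn2real (monge_kantorovich (L y) \<phi> \<psi>))"

lemma monge_kantorovich_eq:
  "monge_kantorovich (L y) \<phi> \<psi> = (SUP a\<in>lip_ball y. ennreal (cmod (\<phi> a - \<psi> a)))"
  unfolding monge_kantorovich_def lip_ball_eq(2)[OF y] ..

text \<open>
  Up to a scalar, on which states agree, an element of the unit ball has norm at most \<open>y 0\<close>.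
\<close>

lemma state_diff_lip_ball:
  assumes \<phi>: "\<phi> \<in> state_space A" "\<psi> \<in> state_space A" and a: "a \<in> lip_ball y"
  shows "cmod (\<phi> a - \<psi> a) \<le> 2 * y 0"
proof -
  have aA: "a \<in> carrier A" and dev: "dev 0 a \<le> y 0"
    using a by (auto intro: lip_ball_carrier lip_ball_dev)
  obtain c where c: "E 0 a = c \<odot> \<one>" using E_0_scalar[OF aA] by blast
  have "cmod (\<phi> a - \<psi> a) \<le> 2 * dev 0 a + cmod (\<phi> (E 0 a) - \<psi> (E 0 a))"
    unfolding dev_def using \<phi> aA by (intro state_diff_le) auto
  also have "\<phi> (E 0 a) - \<psi> (E 0 a) = 0" using \<phi> by (simp add: c state_scale state_one)
  finally show ?thesis using dev by simp
qed

lemma monge_kantorovich_finite: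
  assumes "\<phi> \<in> state_space A" "\<psi> \<in> state_space A"
  shows "monge_kantorovich (L y) \<phi> \<psi> < \<infinity>"
proof -
  have "monge_kantorovich (L y) \<phi> \<psi> \<le> ennreal (2 * y 0)"
    unfolding monge_kantorovich_eq using assms by (intro SUP_least ennreal_leI state_diff_lip_ball)
  also have "\<dots> < \<infinity>" by simp
  finally show ?thesis .
qed

lemma le_mk:
  assumes "\<phi> \<in> state_space A" "\<psi> \<in> state_space A" "a \<in> lip_ball y"
  shows "cmod (\<phi> a - \<psi> a) \<le> mk \<phi> \<psi>"
proof -
  have le: "ennreal (cmod (\<phi> a - \<psi> a)) \<le> monge_kantorovich (L y) \<phi> \<psi>"
    unfolding monge_kantorovich_eq using assms(3) by (rule SUP_upper)
  then show ?thesis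
    using enn2real_mono[OF le] monge_kantorovich_finite[OF assms(1,2)]
    by (simp add: infinity_ennreal_def)
qed

lemma mk_le:
  assumes "0 \<le> r" "\<And>a. a \<in> lip_ball y \<Longrightarrow> cmod (\<phi> a - \<psi> a) \<le> r"
  shows "mk \<phi> \<psi> \<le> r"
proof -
  have "monge_kantorovich (L y) \<phi> \<psi> \<le> ennreal r"
    unfolding monge_kantorovich_eq using assms(2) by (intro SUP_least ennreal_leI)
  with assms(1) show ?thesis by (rule enn2real_leI)
qed

text \<open>
  The weak* topology is coarser than that of the metric: up to a small error, \<open>a\<close> is a
  combination of two self-adjoint elements of a finite stage, which are multiples of elements of
  the unit ball. The same inequality shows that the metric separates states.
\<close>

lemma state_diff_le_mk:
  assumes a: "a \<in> carrier A" and e: "0 < e"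
  shows "\<exists>K>0. \<forall>\<phi>\<in>state_space A. \<forall>\<psi>\<in>state_space A. cmod (\<phi> a - \<psi> a) \<le> e + K * mk \<phi> \<psi>"
proof -
  obtain n b where b: "b \<in> B n" "cnorm A (a \<ominus> b) < e / 2"
    using B_dense[OF a, of "e/2"] e by auto
  define b1 where "b1 = (1 / 2) \<odot> (b \<oplus> star A b)"
  define b2 where "b2 = (1 / (2 * \<i>)) \<odot> (b \<ominus> star A b)"
  have bA: "b \<in> carrier A" using b by simp
  have b1: "b1 \<in> selfadjoint A" and b2: "b2 \<in> selfadjoint A" and b_eq: "b = b1 \<oplus> \<i> \<odot> b2"
    unfolding b1_def b2_def
    by (rule real_part_selfadjoint[OF bA] imaginary_part_selfadjoint[OF bA]
      real_plus_imaginary_part[OF bA, symmetric])+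
  have B: "b1 \<in> B n" "b2 \<in> B n"
    unfolding b1_def b2_def
    by (rule T.B_scale[OF T.B_add[OF b(1) T.B_star[OF b(1)]]]
      T.B_scale[OF T.B_minus[OF b(1) T.B_star[OF b(1)]]])+
  obtain t1 where t1: "0 < t1" "complex_of_real t1 \<odot> b1 \<in> lip_ball y"
    using scaled_in_lip_ball[OF y B(1) b1] by blast
  obtain t2 where t2: "0 < t2" "complex_of_real t2 \<odot> b2 \<in> lip_ball y"
    using scaled_in_lip_ball[OF y B(2) b2] by blast
  show ?thesis
  proof (intro exI[of _ "1 / t1 + 1 / t2"] conjI ballI)
    show "0 < 1 / t1 + 1 / t2" using t1(1) t2(1) by (intro add_pos_pos divide_pos_pos zero_less_one)
    fix \<phi> \<psi> assume \<phi>: "\<phi> \<in> state_space A" and \<psi>: "\<psi> \<in> state_space A"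
    have scaled: "cmod (\<phi> h - \<psi> h) \<le> 1 / t * mk \<phi> \<psi>"
      if h: "h \<in> selfadjoint A" and t: "0 < t" "complex_of_real t \<odot> h \<in> lip_ball y" for h t
    proof -
      have "\<phi> (complex_of_real t \<odot> h) - \<psi> (complex_of_real t \<odot> h) = complex_of_real t * (\<phi> h - \<psi> h)"
        using selfadjoint_carrier[OF h] \<phi> \<psi> by (simp add: state_scale algebra_simps)
      then have "t * cmod (\<phi> h - \<psi> h) \<le> mk \<phi> \<psi>"
        using le_mk[OF \<phi> \<psi> t(2)] t(1) by (simp add: norm_mult)
      then show ?thesis using t(1) by (simp add: field_simps)
    qed
    have "\<phi> b - \<psi> b = (\<phi> b1 - \<psi> b1) + \<i> * (\<phi> b2 - \<psi> b2)"
      using b1[THEN selfadjoint_carrier] b2[THEN selfadjoint_carrier] \<phi> \<psi>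
      by (subst (1 2) b_eq) (simp add: state_add state_scale algebra_simps)
    then have "cmod (\<phi> b - \<psi> b) \<le> cmod (\<phi> b1 - \<psi> b1) + cmod (\<phi> b2 - \<psi> b2)"
      using norm_triangle_ineq[of "\<phi> b1 - \<psi> b1" "\<i> * (\<phi> b2 - \<psi> b2)"] by (simp add: norm_mult)
    also have "\<dots> \<le> 1 / t1 * mk \<phi> \<psi> + 1 / t2 * mk \<phi> \<psi>"
      using scaled[OF b1 t1] scaled[OF b2 t2] by (rule add_mono)
    finally show "cmod (\<phi> a - \<psi> a) \<le> e + (1 / t1 + 1 / t2) * mk \<phi> \<psi>"
      using state_diff_le[OF \<phi> \<psi> a bA] b(2) by (simp add: algebra_simps)
  qed
qed

text \<open>
  The metric topology is coarser than the weak* topology: modulo scalars the unit ball lies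
  within \<open>y N\<close> of a bounded subset of the finite-dimensional stage \<open>N\<close>, on which states are
  controlled by their values on a frame.
\<close>

lemma mk_le_weak_star:
  assumes e: "0 < e"
  shows "\<exists>us. set us \<subseteq> carrier A \<and> (\<forall>\<phi>\<in>state_space A. \<forall>\<psi>\<in>state_space A.
      mk \<phi> \<psi> \<le> e + (\<Sum>u\<leftarrow>us. y 0 * l2norm u * cmod (\<phi> u - \<psi> u)))"
proof -
  have "eventually (\<lambda>n. y n < e / 2) sequentially"
    using order_tendstoD(2)[OF y_lim, of "e/2"] e by simp
  then obtain N where N: "y N < e / 2" by (auto simp: eventually_sequentially)
  show ?thesis
  proof (intro exI[of _ "es N"] conjI ballI)
    show "set (es N) \<subseteq> carrier A" by (rule T.es_carrier)
    fix \<phi> \<psi> assume \<phi>: "\<phi> \<in> state_space A" and \<psi>: "\<psi> \<in> state_space A"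
    define w where "w = (\<Sum>u\<leftarrow>es N. l2norm u * cmod (\<phi> u - \<psi> u))"
    have w: "0 \<le> w" unfolding w_def using T.es_carrier[of N]
      by (intro sum_list_nonneg) auto
    have w_eq: "(\<Sum>u\<leftarrow>es N. y 0 * l2norm u * cmod (\<phi> u - \<psi> u)) = y 0 * w"
      by (simp add: w_def sum_list_const_mult mult.assoc)
    have "mk \<phi> \<psi> \<le> e + y 0 * w"
    proof (rule mk_le)
      show "0 \<le> e + y 0 * w" using e w y[rule_format, of 0] by simp
      fix a assume a: "a \<in> lip_ball y"
      then have aA: "a \<in> carrier A" and dev: "\<And>n. dev n a \<le> y n"
        by (auto intro: lip_ball_carrier lip_ball_dev)
      \<comment> \<open>Subtracting the scalar \<open>E 0 a\<close> does not affect differences of states and bounds the norm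
        of \<open>c\<close> independently of \<open>a\<close>.\<close>
      define c where "c = E N (a \<ominus> E 0 a)"
      have cB: "c \<in> B N" unfolding c_def using aA by (intro T.E_in_B) auto
      have "E 0 a \<in> B N" using T.E_in_B[OF aA, of 0] B_mono[of 0 N] by auto
      then have c_eq: "c = E N a \<ominus> E 0 a" using aA by (simp add: c_def E_minus E_id)
      obtain z where z: "E 0 a = z \<odot> \<one>" using E_0_scalar[OF aA] by blast
      have "\<phi> (E N a) - \<psi> (E N a) = \<phi> c - \<psi> c"
        using \<phi> \<psi> aA by (simp add: c_eq state_minus z state_scale state_one)
      then have "cmod (\<phi> a - \<psi> a) \<le> 2 * dev N a + cmod (\<phi> c - \<psi> c)"
        using state_diff_le[OF \<phi> \<psi> aA E_closed[OF aA, of N]] by (simp add: dev_def)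
      also have "cmod (\<phi> c - \<psi> c) \<le> l2norm c * w"
        using state_diff_frame_op[OF \<phi> \<psi> T.es_carrier[of N], of c] cB by (simp add: E_id w_def)
      also have "l2norm c \<le> y 0"
      proof -
        have "l2norm c \<le> cnorm A c" using cB by (simp add: l2norm_le_cnorm)
        also have "\<dots> \<le> dev 0 a" unfolding c_def dev_def using aA by (intro T.cnorm_E_le) auto
        finally show ?thesis using dev[of 0] by simp
      qed
      finally show "cmod (\<phi> a - \<psi> a) \<le> e + y 0 * w"
        using dev[of N] N w by (simp add: mult_right_mono)
    qed
    then show "mk \<phi> \<psi> \<le> e + (\<Sum>u\<leftarrow>es N. y 0 * l2norm u * cmod (\<phi> u - \<psi> u))" by (simp add: w_eq)
  qed
qed

lemma Metric_space_mk: "Metric_space (state_space A) mk"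
proof
  show "0 \<le> mk \<phi> \<psi>" for \<phi> \<psi> by simp
  show "mk \<phi> \<psi> = mk \<psi> \<phi>" for \<phi> \<psi>
  proof -
    have "(\<lambda>a. ennreal (cmod (\<phi> a - \<psi> a))) = (\<lambda>a. ennreal (cmod (\<psi> a - \<phi> a)))"
      by (rule ext, rule arg_cong[where f = ennreal], rule norm_minus_commute)
    then show ?thesis by (simp only: monge_kantorovich_eq)
  qed
next
  fix \<phi> \<psi> assume \<phi>: "\<phi> \<in> state_space A" and \<psi>: "\<psi> \<in> state_space A"
  show "mk \<phi> \<psi> = 0 \<longleftrightarrow> \<phi> = \<psi>"
  proof
    assume 0: "mk \<phi> \<psi> = 0"
    have "\<phi> a = \<psi> a" if a: "a \<in> carrier A" for a
    proof -
      have "cmod (\<phi> a - \<psi> a) \<le> e" if e: "0 < e" for e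
      proof -
        obtain K where "cmod (\<phi> a - \<psi> a) \<le> e + K * mk \<phi> \<psi>"
          using state_diff_le_mk[OF a e] \<phi> \<psi> by blast
        then show ?thesis by (simp add: 0)
      qed
      then have "cmod (\<phi> a - \<psi> a) \<le> 0" using field_le_epsilon[of "cmod (\<phi> a - \<psi> a)" 0] by simp
      then show ?thesis by simp
    qed
    then show "\<phi> = \<psi>"
      using \<phi> \<psi> by (intro extensionalityI[of _ "carrier A"]) (auto simp: state_space_def)
  next
    assume "\<phi> = \<psi>"
    then have "mk \<phi> \<psi> \<le> 0" by (intro mk_le) auto
    then show "mk \<phi> \<psi> = 0" by (simp add: order_antisym)
  qed
next
  fix \<phi> \<psi> \<eta> assume \<phi>: "\<phi> \<in> state_space A" and \<psi>: "\<psi> \<in> state_space A" and \<eta>: "\<eta> \<in> state_space A"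
  show "mk \<phi> \<eta> \<le> mk \<phi> \<psi> + mk \<psi> \<eta>"
  proof (rule mk_le)
    fix a assume a: "a \<in> lip_ball y"
    have "cmod (\<phi> a - \<eta> a) \<le> cmod (\<phi> a - \<psi> a) + cmod (\<psi> a - \<eta> a)"
      using norm_triangle_ineq[of "\<phi> a - \<psi> a" "\<psi> a - \<eta> a"] by simp
    then show "cmod (\<phi> a - \<eta> a) \<le> mk \<phi> \<psi> + mk \<psi> \<eta>"
      using le_mk[OF \<phi> \<psi> a] le_mk[OF \<psi> \<eta> a] by linarith
  qed simp
qed

lemma mtopology_mk: "Metric_space.mtopology (state_space A) mk = weak_star_topology A"
proof -
  interpret M: Metric_space "state_space A" mk by (rule Metric_space_mk)
  have top_weak: "topspace (weak_star_topology A) = state_space A"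
    by (auto simp: weak_star_topology_def state_space_def PiE_def)
  have weak_open: "openin (weak_star_topology A) U" if U: "openin M.mtopology U" for U
  proof (subst openin_subopen, intro ballI)
    fix \<phi> assume "\<phi> \<in> U"
    then obtain r where r: "0 < r" "M.mball \<phi> r \<subseteq> U" and \<phi>: "\<phi> \<in> state_space A"
      using U unfolding M.openin_mtopology by blast
    obtain us where us: "set us \<subseteq> carrier A"
      and mk: "\<forall>\<phi>\<in>state_space A. \<forall>\<psi>\<in>state_space A. mk \<phi> \<psi> \<le> r / 2 + (\<Sum>u\<leftarrow>us. y 0 * l2norm u * cmod (\<phi> u - \<psi> u))"
      using mk_le_weak_star[OF half_gt_zero[OF r(1)]] by blast
    define w where "w \<psi> = (\<Sum>u\<leftarrow>us. y 0 * l2norm u * cmod (\<phi> u - \<psi> u))" for \<psi>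
    let ?V = "{\<psi> \<in> topspace (weak_star_topology A). w \<psi> \<in> {..<r/2}}"
    have "openin (weak_star_topology A) ?V"
      unfolding w_def by (intro openin_continuous_map_preimage[OF continuous_map_weak_star[OF us]]) auto
    moreover have "w \<phi> = 0" unfolding w_def by (induction us) auto
    then have "\<phi> \<in> ?V" using \<phi> r(1) top_weak by simp
    moreover have "?V \<subseteq> U"
    proof
      fix \<psi> assume "\<psi> \<in> ?V"
      then have "\<psi> \<in> state_space A" "w \<psi> < r / 2" using top_weak by auto
      then have "\<psi> \<in> M.mball \<phi> r" using mk[rule_format, of \<phi> \<psi>] \<phi> by (simp add: w_def)
      then show "\<psi> \<in> U" using r(2) by blast
    qed
    ultimately show "\<exists>V. openin (weak_star_topology A) V \<and> \<phi> \<in> V \<and> V \<subseteq> U" by blast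
  qed
  have coordinate: "continuous_map M.mtopology euclidean (\<lambda>\<phi>. \<phi> a)" if a: "a \<in> carrier A" for a
    unfolding continuous_map_def
  proof (intro conjI allI impI)
    fix V :: "complex set" assume "openin euclidean V"
    then have V: "open V" by simp
    show "openin M.mtopology {\<phi> \<in> topspace M.mtopology. \<phi> a \<in> V}"
      unfolding M.openin_mtopology
    proof (intro conjI allI impI)
      fix \<phi> assume "\<phi> \<in> {\<phi> \<in> topspace M.mtopology. \<phi> a \<in> V}"
      then have \<phi>: "\<phi> \<in> state_space A" "\<phi> a \<in> V" by auto
      obtain e where e: "0 < e" "\<And>z. dist z (\<phi> a) < e \<Longrightarrow> z \<in> V"
        using V \<phi>(2) unfolding open_dist by blast
      obtain K where K: "0 < K"
        "\<forall>\<phi>\<in>state_space A. \<forall>\<psi>\<in>state_space A. cmod (\<phi> a - \<psi> a) \<le> e/2 + K * mk \<phi> \<psi>"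
        using state_diff_le_mk[OF a half_gt_zero[OF e(1)]] by blast
      have "M.mball \<phi> (e / (2 * K)) \<subseteq> {\<phi> \<in> topspace M.mtopology. \<phi> a \<in> V}"
      proof
        fix \<psi> assume "\<psi> \<in> M.mball \<phi> (e / (2 * K))"
        then have \<psi>: "\<psi> \<in> state_space A" "mk \<phi> \<psi> < e / (2 * K)" by auto
        then have "K * mk \<phi> \<psi> < e / 2" using K(1) by (simp add: field_simps)
        then have "dist (\<psi> a) (\<phi> a) < e"
          using K(2)[rule_format, OF \<phi>(1) \<psi>(1)] by (simp add: dist_norm norm_minus_commute)
        then show "\<psi> \<in> {\<phi> \<in> topspace M.mtopology. \<phi> a \<in> V}" using e(2) \<psi>(1) by simp
      qed
      then show "\<exists>r>0. M.mball \<phi> r \<subseteq> {\<phi> \<in> topspace M.mtopology. \<phi> a \<in> V}"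
        using e(1) K(1) by (intro exI[of _ "e / (2 * K)"]) simp
    qed auto
  qed auto
  have "state_space A \<subseteq> extensional (carrier A)" by (auto simp: state_space_def)
  then have "continuous_map M.mtopology (product_topology (\<lambda>_. euclidean) (carrier A)) (\<lambda>\<phi>. \<phi>)"
    unfolding continuous_map_componentwise using coordinate by auto
  then have id: "continuous_map M.mtopology (weak_star_topology A) (\<lambda>\<phi>. \<phi>)"
    unfolding weak_star_topology_def by (simp add: continuous_map_in_subtopology)
  have metric_open: "openin M.mtopology U" if U: "openin (weak_star_topology A) U" for U
  proof -
    have "openin M.mtopology {\<phi> \<in> topspace M.mtopology. \<phi> \<in> U}"
      using id U by (rule openin_continuous_map_preimage)
    also have "{\<phi> \<in> topspace M.mtopology. \<phi> \<in> U} = U"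
      using openin_subset[OF U] top_weak by auto
    finally show ?thesis .
  qed
  show ?thesis unfolding topology_eq using weak_open metric_open by blast
qed

lemma metrizes_weak_star_L: "metrizes_weak_star A (L y)"
  unfolding metrizes_weak_star_def
  using monge_kantorovich_finite Metric_space_mk mtopology_mk by blast

end

section \<open>The quasi-Leibniz quantum compact metric space\<close>

context af_lip
begin

lemma dom_lipE:
  assumes "a \<in> dom_lip (L y)"
  obtains r where "0 \<le> r" "L y a = ennreal r" "a \<in> selfadjoint A" "a \<in> carrier A"
    "\<forall>n. dev n a \<le> r * y n"
proof -
  obtain r where r: "0 \<le> r" "L y a = ennreal r" "a \<in> selfadjoint A"
    using assms L_finite by (auto simp: dom_lip_def)
  moreover have "dev n a \<le> r * y n" for n using L_le_iff[OF y r(1), of a] r(2) by simp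
  ultimately show ?thesis using that selfadjoint_carrier by blast
qed

lemma dom_lipI:
  assumes "0 \<le> r" "a \<in> selfadjoint A" "\<And>n. dev n a \<le> r * y n"
  shows "a \<in> dom_lip (L y)"
proof -
  have "L y a \<le> ennreal r" using L_le_iff[OF y assms(1), of a] assms(2,3) by blast
  also have "\<dots> < \<infinity>" by simp
  finally show ?thesis by (simp add: dom_lip_def)
qed

lemma L_add:
  assumes "a \<in> dom_lip (L y)" "b \<in> dom_lip (L y)"
  shows "L y (a \<oplus> b) \<le> L y a + L y b"
proof -
  from assms(1) obtain r where r: "0 \<le> r" "L y a = ennreal r" "a \<in> selfadjoint A" "a \<in> carrier A"
    "\<forall>n. dev n a \<le> r * y n" by (rule dom_lipE)
  from assms(2) obtain s where s: "0 \<le> s" "L y b = ennreal s" "b \<in> selfadjoint A" "b \<in> carrier A"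
    "\<forall>n. dev n b \<le> s * y n" by (rule dom_lipE)
  have "dev n (a \<oplus> b) \<le> (r + s) * y n" for n
    using dev_add[OF r(4) s(4), of n] r(5)[rule_format, of n] s(5)[rule_format, of n] by (simp add: algebra_simps)
  then have "L y (a \<oplus> b) \<le> ennreal (r + s)"
    using L_le_iff[OF y, of "r + s" "a \<oplus> b"] r s by (simp add: selfadjoint_add)
  then show ?thesis using r s by simp
qed

lemma L_scale:
  assumes "a \<in> dom_lip (L y)"
  shows "L y (complex_of_real t \<odot> a) = ennreal \<bar>t\<bar> * L y a"
proof -
  have a: "a \<in> selfadjoint A" "a \<in> carrier A" using assms by (auto elim: dom_lipE)
  have "L y (complex_of_real t \<odot> a) = (SUP n. ennreal \<bar>t\<bar> * ennreal (dev n a / y n))"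
    using a by (simp add: L_def selfadjoint_scale dev_scale flip: ennreal_mult')
  also have "\<dots> = ennreal \<bar>t\<bar> * (SUP n. ennreal (dev n a / y n))"
    by (rule SUP_mult_left_ennreal[symmetric])
  finally show ?thesis using a by (simp add: L_def)
qed

lemma L_Leibniz:
  assumes "a \<in> dom_lip (L y)" "b \<in> dom_lip (L y)"
  shows "max (L y (jordan_product A a b)) (L y (lie_product A a b))
    \<le> 2 * (ennreal (cnorm A a) * L y b + ennreal (cnorm A b) * L y a)"
proof -
  from assms(1) obtain r where r: "0 \<le> r" "L y a = ennreal r" "a \<in> selfadjoint A" "a \<in> carrier A"
    "\<forall>n. dev n a \<le> r * y n" by (rule dom_lipE)
  from assms(2) obtain s where s: "0 \<le> s" "L y b = ennreal s" "b \<in> selfadjoint A" "b \<in> carrier A"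
    "\<forall>n. dev n b \<le> s * y n" by (rule dom_lipE)
  define K where "K = 2 * (cnorm A a * s + cnorm A b * r)"
  have K0: "0 \<le> cnorm A a * s" "0 \<le> cnorm A b * r"
    using r s by (simp_all add: cnorm_nonneg)
  then have K: "0 \<le> K" by (simp add: K_def)
  have bound: "2 * (cnorm A a * dev n b + cnorm A b * dev n a) \<le> K * y n" for n
  proof -
    have "cnorm A a * dev n b \<le> cnorm A a * (s * y n)" "cnorm A b * dev n a \<le> cnorm A b * (r * y n)"
      using r s by (auto intro!: mult_left_mono cnorm_nonneg)
    then show ?thesis by (simp add: K_def algebra_simps)
  qed
  have "L y (jordan_product A a b) \<le> ennreal K"
    using L_le_iff[OF y K, of "jordan_product A a b"] selfadjoint_jordan[OF r(3) s(3)]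
      order_trans[OF dev_jordan[OF r(4) s(4)] bound] by blast
  moreover have "L y (lie_product A a b) \<le> ennreal K"
    using L_le_iff[OF y K, of "lie_product A a b"] selfadjoint_lie[OF r(3) s(3)]
      order_trans[OF dev_lie[OF r(4) s(4)] bound] by blast
  moreover have "ennreal K = 2 * (ennreal (cnorm A a) * L y b + ennreal (cnorm A b) * L y a)"
    unfolding K_def r(2) s(2) using K0 r s
    by (simp add: ennreal_mult' ennreal_plus cnorm_nonneg distrib_left flip: ennreal_numeral)
  ultimately show ?thesis by simp
qed

lemma jordan_lie_subalgebra_dom: "jordan_lie_subalgebra A (dom_lip (L y))"
proof -
  have fin: "b \<in> dom_lip (L y)" if "L y b \<le> c" "c < \<infinity>" for b c
    using le_less_trans[OF that] by (simp add: dom_lip_def)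
  have finite: "L y a < \<infinity>" if "a \<in> dom_lip (L y)" for a using that by (simp add: dom_lip_def)
  show ?thesis
    unfolding jordan_lie_subalgebra_def
  proof (intro conjI ballI allI)
    show "dom_lip (L y) \<subseteq> selfadjoint A" by (auto elim: dom_lipE)
    show "\<zero> \<in> dom_lip (L y)"
      using T.zero_in_B by (intro dom_lipI[of 0]) (auto simp: selfadjoint_def dev_in_B)
  next
    fix a b assume ab: "a \<in> dom_lip (L y)" "b \<in> dom_lip (L y)"
    show "a \<oplus> b \<in> dom_lip (L y)"
      by (rule fin[OF L_add[OF ab]]) (use finite ab in simp)
    have lt: "2 * (ennreal (cnorm A a) * L y b + ennreal (cnorm A b) * L y a) < \<infinity>"
      using finite ab by (simp add: ennreal_mult_less_top)
    show "jordan_product A a b \<in> dom_lip (L y)" "lie_product A a b \<in> dom_lip (L y)"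
      using L_Leibniz[OF ab] lt by (auto intro: fin)
  next
    fix t :: real and a assume a: "a \<in> dom_lip (L y)"
    show "complex_of_real t \<odot> a \<in> dom_lip (L y)"
      by (rule fin[of _ "ennreal \<bar>t\<bar> * L y a"])
        (use finite a L_scale[OF a] in \<open>simp_all add: ennreal_mult_less_top\<close>)
  qed
qed

lemma dom_dense: "selfadjoint A \<subseteq> norm_topology A closure_of dom_lip (L y)"
proof
  fix a assume a: "a \<in> selfadjoint A"
  interpret M: Metric_space "carrier A" "cstar_dist A" by (rule Metric_space_cstar)
  have aA: "a \<in> carrier A" using a by (rule selfadjoint_carrier)
  have "\<exists>d\<in>dom_lip (L y). d \<in> M.mball a e" if e: "0 < e" for e
  proof -
    obtain n b where b: "b \<in> B n" "cnorm A (a \<ominus> b) < e" using B_dense[OF aA e] by blast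
    \<comment> \<open>The real part of \<open>b\<close> is self-adjoint and no further from \<open>a\<close> than \<open>b\<close> itself.\<close>
    define h where "h = (1/2) \<odot> (b \<oplus> star A b)"
    have bA: "b \<in> carrier A" using b by simp
    have hB: "h \<in> B n"
      unfolding h_def by (rule T.B_scale[OF T.B_add[OF b(1) T.B_star[OF b(1)]]])
    have h: "h \<in> selfadjoint A" unfolding h_def using bA by (rule real_part_selfadjoint)
    obtain t where t: "0 < t" "complex_of_real t \<odot> h \<in> lip_ball y"
      using scaled_in_lip_ball[OF y hB h] by blast
    have "dev n h \<le> (1 / t) * y n" for n
      using lip_ball_dev[OF t(2), of n] t(1) selfadjoint_carrier[OF h]
      by (simp add: dev_scale field_simps)
    then have "h \<in> dom_lip (L y)" using t(1) h by (intro dom_lipI[of "1/t"]) auto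
    moreover have "cnorm A (a \<ominus> h) < e"
    proof -
      have "a \<ominus> h = (1/2) \<odot> ((a \<oplus> a) \<ominus> (b \<oplus> star A b))"
        using aA bA scale_minus_right[of "a \<oplus> a" "b \<oplus> star A b" "1/2"]
        by (simp add: h_def half_double)
      moreover have "(a \<oplus> a) \<ominus> (b \<oplus> star A b) = (a \<ominus> b) \<oplus> (a \<ominus> star A b)"
        using aA bA star_carrier[OF bA] by algebra
      moreover have "a \<ominus> star A b = star A (a \<ominus> b)"
        using a bA aA by (simp add: star_minus selfadjoint_def)
      ultimately have "cnorm A (a \<ominus> h) = cnorm A ((a \<ominus> b) \<oplus> star A (a \<ominus> b)) / 2"
        using aA bA by (simp add: cnorm_smult norm_divide)
      also have "\<dots> \<le> cnorm A (a \<ominus> b)"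
        using cnorm_triangle[of "a \<ominus> b" "star A (a \<ominus> b)"] aA bA by (simp add: cnorm_star)
      finally show ?thesis using b(2) by simp
    qed
    ultimately show ?thesis
      using aA selfadjoint_carrier[OF h] by (intro bexI[of _ h]) (auto simp: cstar_dist_def)
  qed
  then show "a \<in> norm_topology A closure_of dom_lip (L y)"
    unfolding norm_topology_def M.metric_closure_of using aA by blast
qed

text \<open>
  Vanishing of the seminorm of stage \<open>0\<close> alone forces \<open>a\<close> to be a scalar.
\<close>

lemma L_kernel: "{a \<in> selfadjoint A. L y a = 0} = range (\<lambda>t::real. complex_of_real t \<odot> \<one>)"
proof (intro equalityI subsetI)
  fix a assume "a \<in> {a \<in> selfadjoint A. L y a = 0}"
  then have a: "a \<in> selfadjoint A" "L y a \<le> ennreal 0" by auto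
  then have aA: "a \<in> carrier A" by (simp add: selfadjoint_carrier)
  have "dev 0 a \<le> 0" using L_le_iff[OF y, of 0 a] a by simp
  then have "dev 0 a = 0" using dev_nonneg[OF aA, of 0] by simp
  then have "a = E 0 a" using cnorm_minus_eq_zero[of a "E 0 a"] aA by (simp add: dev_def)
  then obtain c where c: "a = c \<odot> \<one>" using E_0_scalar[OF aA] by auto
  have "cnj c \<odot> \<one> = c \<odot> \<one>" using a(1) by (simp add: c selfadjoint_def star_smult)
  moreover have "\<ominus> (c \<odot> \<one>) \<oplus> c \<odot> \<one> = \<zero>" using scale_closed[of \<one> c] by algebra
  ultimately have "(cnj c - c) \<odot> \<one> = \<zero>"
    using cnorm_minus_eq_zero[of "c \<odot> \<one>" "c \<odot> \<one>"] by (simp add: scale_minus_left cnorm_eq_zero)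
  then have "cmod (cnj c - c) = 0" using cnorm_smult[of \<one> "cnj c - c"] by simp
  then have "c \<in> \<real>" by (simp add: Reals_cnj_iff)
  then show "a \<in> range (\<lambda>t::real. complex_of_real t \<odot> \<one>)" using c by (auto elim: Reals_cases)
next
  fix a assume "a \<in> range (\<lambda>t::real. complex_of_real t \<odot> \<one>)"
  then obtain t :: real where a: "a = complex_of_real t \<odot> \<one>" by blast
  have "a \<in> B n" for n unfolding a by (rule T.B_scale[OF T.one_in_B])
  then have "L y a = 0" "a \<in> selfadjoint A"
    by (auto simp: L_def dev_in_B) (auto simp: a selfadjoint_def star_smult)
  then show "a \<in> {a \<in> selfadjoint A. L y a = 0}" by simp
qed

text \<open>
  A supremum of continuous functions.
\<close>

lemma L_lower_semicontinuous:
  "openin (subtopology (norm_topology A) (selfadjoint A)) {a \<in> selfadjoint A. r < L y a}"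
proof -
  interpret M: Metric_space "carrier A" "cstar_dist A" by (rule Metric_space_cstar)
  define W where "W = {a \<in> carrier A. \<exists>n. r < ennreal (dev n a / y n)}"
  have "openin M.mtopology W"
    unfolding M.openin_mtopology
  proof (intro conjI allI impI)
    fix a assume "a \<in> W"
    then obtain n where a: "a \<in> carrier A" and n: "r < ennreal (dev n a / y n)"
      by (auto simp: W_def)
    obtain s where s: "0 \<le> s" "r = ennreal s" using n by (cases r) auto
    have yn: "0 < y n" using y by blast
    have gap: "s * y n < dev n a"
      using n s yn by (simp add: s(2) ennreal_less_iff less_divide_eq)
    define \<rho> where "\<rho> = (dev n a - s * y n) / 2"
    have "M.mball a \<rho> \<subseteq> W"
    proof
      fix b assume "b \<in> M.mball a \<rho>"
      then have b: "b \<in> carrier A" "cnorm A (a \<ominus> b) < \<rho>" using a by (auto simp: cstar_dist_def)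
      have "s * y n < dev n b" using dev_diff_le[OF a b(1), of n] b(2) by (simp add: \<rho>_def)
      then have "r < ennreal (dev n b / y n)"
        using s yn by (simp add: s(2) ennreal_less_iff less_divide_eq)
      then show "b \<in> W" using b(1) by (auto simp: W_def)
    qed
    then show "\<exists>\<rho>>0. M.mball a \<rho> \<subseteq> W" using gap by (intro exI[of _ \<rho>]) (simp add: \<rho>_def)
  qed (auto simp: W_def)
  moreover have "{a \<in> selfadjoint A. r < L y a} = W \<inter> selfadjoint A"
    by (auto simp: W_def L_def less_SUP_iff selfadjoint_carrier)
  ultimately show ?thesis by (auto simp: openin_subtopology norm_topology_def)
qed

theorem quasi_leibniz_qcms_L: "quasi_leibniz_qcms (A, L y)"
  unfolding quasi_leibniz_qcms_def prod.case
  using unital_cstar_algebra_axioms jordan_lie_subalgebra_dom dom_dense L_add L_scale L_kernel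
    L_Leibniz metrizes_weak_star_L L_lower_semicontinuous
  by blast

end

section \<open>The identity bridge\<close>

lemma hausdorff_distance_self:
  assumes "\<And>s. s \<in> S \<Longrightarrow> d s s = 0"
  shows "hausdorff_distance d S S = 0"
proof -
  have "(INF t\<in>S. d s t) \<le> 0" "(INF t\<in>S. d t s) \<le> 0" if "s \<in> S" for s
    using assms[OF that] INF_lower[OF that, of "d s"] INF_lower[OF that, of "\<lambda>t. d t s"] by simp_all
  then have "hausdorff_distance d S S \<le> 0"
    unfolding hausdorff_distance_def by (intro max.boundedI SUP_least)
  then show ?thesis by simp
qed

lemma quantum_propinquity_le_bridge_length:
  assumes "quasi_leibniz_qcms X" "quasi_leibniz_qcms Y" "is_bridge (fst X) (fst Y) \<gamma>"
  shows "quantum_propinquity X Y \<le> bridge_length X Y \<gamma>"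
  unfolding quantum_propinquity_def
  by (rule SUP_least) (use assms in \<open>unfold propinquity_bounded_def, blast\<close>)

context unital_cstar_algebra
begin

lemma level_states_one: "level_states A \<one> = state_space A"
proof -
  have "\<one> \<ominus> \<one> = \<zero>" by algebra
  then show ?thesis by (auto simp: level_states_def state_zero)
qed

text \<open>
  For two Lip-norms on the same algebra, the algebra itself with pivot \<open>1\<close>: every state is a level
  state, hence the height vanishes and the length is the reach.
\<close>

definition identity_bridge :: "'a bridge" where
  "identity_bridge = \<lparr>bridge_algebra = A, left_map = \<lambda>a. a, right_map = \<lambda>a. a, pivot = \<one>\<rparr>"

lemma is_bridge_identity: "state_space A \<noteq> {} \<Longrightarrow> is_bridge A A identity_bridge"
  using unital_cstar_algebra_axioms
  by (simp add: is_bridge_def identity_bridge_def level_states_one unital_star_mono_def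
    unital_star_hom_def ring_hom_def)

lemma bridge_height_identity: "bridge_height (A, K) (A, K') identity_bridge = 0"
proof -
  have "{compose (carrier A) \<phi> (\<lambda>a. a) |\<phi>. \<phi> \<in> state_space A} = state_space A"
  proof -
    have "compose (carrier A) \<phi> (\<lambda>a. a) = \<phi>" if "\<phi> \<in> state_space A" for \<phi>
      using that by (auto simp: state_space_def compose_def extensional_restrict)
    then show ?thesis by force
  qed
  moreover have "monge_kantorovich M \<phi> \<phi> = 0" for M :: "'a \<Rightarrow> ennreal" and \<phi>
  proof -
    have "monge_kantorovich M \<phi> \<phi> \<le> 0" unfolding monge_kantorovich_def by (rule SUP_least) simp
    then show ?thesis by simp
  qed
  ultimately show ?thesis
    by (simp add: identity_bridge_def level_states_one hausdorff_distance_self)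
qed

end

section \<open>Distance between the Lip-norms of two sequences\<close>

context af_tower
begin

text \<open>
  The approximant is the point \<open>b\<close> on the segment from \<open>E 0 a\<close> to \<open>E N a\<close>. It lies in stage \<open>N\<close>, so only the
  conditions with \<open>n < N\<close> are at stake; there the tower property and contractivity bound the seminorm
  of \<open>E N a\<close> by \<open>y n\<close>, and the factor \<open>t\<close> brings this below \<open>z n\<close>. The segment has length at most
  \<open>y 0\<close>, whatever the norm of \<open>a\<close>.
\<close>

lemma lip_ball_approx:
  assumes a: "a \<in> lip_ball y" and t: "0 \<le> t" "t \<le> 1"
    and le: "\<And>n. n < N \<Longrightarrow> t * y n \<le> z n" and z: "\<And>n. 0 < z n"
  shows "\<exists>b\<in>lip_ball z. cnorm A (a \<ominus> b) \<le> y N + (1 - t) * y 0"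
proof -
  have aA: "a \<in> carrier A" and sa: "a \<in> selfadjoint A" and dev: "\<And>n. dev n a \<le> y n"
    using a by (auto simp: lip_ball_def selfadjoint_carrier)
  define b where "b = complex_of_real t \<odot> E N a \<oplus> complex_of_real (1 - t) \<odot> E 0 a"
  have E0: "E 0 a \<in> B n" for n using T.E_in_B[OF aA, of 0] B_mono[of 0 n] by auto
  have b: "b \<in> selfadjoint A"
    unfolding b_def using sa by (intro selfadjoint_add selfadjoint_scale selfadjoint_E)
  have "dev n b \<le> z n" for n
  proof -
    have "dev n b \<le> dev n (complex_of_real t \<odot> E N a) + dev n (complex_of_real (1 - t) \<odot> E 0 a)"
      unfolding b_def using aA by (intro dev_add) auto
    then have le_t: "dev n b \<le> t * dev n (E N a)"
      using aA t dev_in_B[OF E0[of n]] by (simp add: dev_scale)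
    show ?thesis
    proof (cases "n < N")
      case True
      have "dev n (E N a) = cnorm A (E N (a \<ominus> E n a))"
      proof -
        have "E n a \<in> B N" using T.E_in_B[OF aA, of n] B_mono[of n N] True by auto
        then show ?thesis using True aA by (simp add: dev_def E_E E_minus E_id)
      qed
      also have "\<dots> \<le> y n" using T.cnorm_E_le[of "a \<ominus> E n a" N] dev[of n] aA by (simp add: dev_def)
      finally have "t * dev n (E N a) \<le> t * y n" using t by (intro mult_left_mono)
      then show ?thesis using le_t le[OF True] by simp
    next
      case False
      then have "E N a \<in> B n" using T.E_in_B[OF aA, of N] B_mono[of N n] by auto
      then show ?thesis using le_t z[of n] by (simp add: dev_in_B)
    qed
  qed
  then have "b \<in> lip_ball z" using b by (simp add: lip_ball_def)
  moreover have "cnorm A (a \<ominus> b) \<le> y N + (1 - t) * y 0"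
  proof -
    define c where "c = E N a \<ominus> E 0 a"
    have c: "c \<in> carrier A" using aA by (simp add: c_def)
    have "b = E N a \<ominus> complex_of_real (1 - t) \<odot> c"
    proof -
      have "complex_of_real t \<odot> E N a = E N a \<ominus> complex_of_real (1 - t) \<odot> E N a"
        using scale_minus_left[OF E_closed[OF aA, of N], of 1 "complex_of_real (1 - t)"] aA
        by (simp add: scale_1)
      moreover have "p \<ominus> q \<oplus> r = p \<ominus> (q \<ominus> r)"
        if "p \<in> carrier A" "q \<in> carrier A" "r \<in> carrier A" for p q r using that by algebra
      ultimately show ?thesis using aA by (simp add: b_def c_def scale_minus_right)
    qed
    moreover have "a \<ominus> (p \<ominus> q) = (a \<ominus> p) \<oplus> q" if "p \<in> carrier A" "q \<in> carrier A" for p q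
      using that aA by algebra
    ultimately have "cnorm A (a \<ominus> b) \<le> cnorm A (a \<ominus> E N a) + cnorm A (complex_of_real (1 - t) \<odot> c)"
      using aA c by (simp add: cnorm_triangle)
    also have "\<dots> = dev N a + (1 - t) * cnorm A c"
      using c t by (simp add: cnorm_smult dev_def del: of_real_diff)
    also have "cnorm A c \<le> y 0"
    proof -
      have "c = E N (a \<ominus> E 0 a)" using aA E0[of N] by (simp add: c_def E_minus E_id)
      then have "cnorm A c \<le> dev 0 a" using aA T.cnorm_E_le[of "a \<ominus> E 0 a" N] by (simp add: dev_def)
      then show ?thesis using dev[of 0] by simp
    qed
    finally show ?thesis using dev[of N] t by (simp add: mult_left_mono)
  qed
  ultimately show ?thesis by blast
qed

lemma bridge_reach_identity_le:
  assumes y: "\<forall>n. 0 < y n" and z: "\<forall>n. 0 < z n"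
    and yz: "\<And>a. a \<in> lip_ball y \<Longrightarrow> \<exists>b\<in>lip_ball z. cnorm A (a \<ominus> b) \<le> \<epsilon>"
    and zy: "\<And>b. b \<in> lip_ball z \<Longrightarrow> \<exists>a\<in>lip_ball y. cnorm A (b \<ominus> a) \<le> \<epsilon>"
  shows "bridge_reach (A, L y) (A, L z) identity_bridge \<le> ennreal \<epsilon>"
proof -
  define d where "d a b = ennreal (cnorm A (a \<otimes> \<one> \<ominus> \<one> \<otimes> b))" for a b
  have d: "d a b = ennreal (cnorm A (a \<ominus> b))" "d a b = ennreal (cnorm A (b \<ominus> a))"
    if "a \<in> lip_ball y" "b \<in> lip_ball z" for a b
    using lip_ball_carrier[OF that(1)] lip_ball_carrier[OF that(2)]
    by (simp_all add: d_def cnorm_minus_commute[of a b])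
  have "(SUP a\<in>lip_ball y. INF b\<in>lip_ball z. d a b) \<le> ennreal \<epsilon>"
  proof (rule SUP_least)
    fix a assume a: "a \<in> lip_ball y"
    obtain b where "b \<in> lip_ball z" "cnorm A (a \<ominus> b) \<le> \<epsilon>" using yz[OF a] by blast
    then show "(INF b\<in>lip_ball z. d a b) \<le> ennreal \<epsilon>"
      by (intro INF_lower2[of b]) (simp_all add: d(1)[OF a] ennreal_leI)
  qed
  moreover have "(SUP b\<in>lip_ball z. INF a\<in>lip_ball y. d a b) \<le> ennreal \<epsilon>"
  proof (rule SUP_least)
    fix b assume b: "b \<in> lip_ball z"
    obtain a where "a \<in> lip_ball y" "cnorm A (b \<ominus> a) \<le> \<epsilon>" using zy[OF b] by blast
    then show "(INF a\<in>lip_ball y. d a b) \<le> ennreal \<epsilon>"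
      by (intro INF_lower2[of a]) (simp_all add: d(2)[OF _ b] ennreal_leI)
  qed
  ultimately show ?thesis
    by (simp add: identity_bridge_def Let_def lip_ball_eq(1)[OF y] lip_ball_eq(1)[OF z]
      hausdorff_distance_def d_def)
qed

theorem quantum_propinquity_L_le:
  assumes y: "\<forall>n. 0 < y n" "y \<longlonglongrightarrow> 0" and z: "\<forall>n. 0 < z n" "z \<longlonglongrightarrow> 0"
    and t: "0 \<le> t" "t \<le> 1"
    and close: "\<And>n. n < N \<Longrightarrow> t * y n \<le> z n \<and> t * z n \<le> y n"
    and \<epsilon>: "y N + (1 - t) * y 0 \<le> \<epsilon>" "z N + (1 - t) * z 0 \<le> \<epsilon>"
  shows "quantum_propinquity (A, L y) (A, L z) \<le> ennreal \<epsilon>"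
proof -
  interpret Y: af_lip A \<mu> B es y by unfold_locales (fact y)+
  interpret Z: af_lip A \<mu> B es z by unfold_locales (fact z)+
  have "quantum_propinquity (A, L y) (A, L z) \<le> bridge_length (A, L y) (A, L z) identity_bridge"
    by (rule quantum_propinquity_le_bridge_length)
      (simp_all add: Y.quasi_leibniz_qcms_L Z.quasi_leibniz_qcms_L is_bridge_identity state_space_nonempty)
  also have "\<dots> = bridge_reach (A, L y) (A, L z) identity_bridge"
    by (simp only: bridge_length_def bridge_height_identity) simp
  also have "\<dots> \<le> ennreal \<epsilon>"
  proof (rule bridge_reach_identity_le[OF y(1) z(1)])
    fix a assume a: "a \<in> lip_ball y"
    have "\<exists>b\<in>lip_ball z. cnorm A (a \<ominus> b) \<le> y N + (1 - t) * y 0"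
      by (rule lip_ball_approx[OF a t]) (use close z(1) in auto)
    then show "\<exists>b\<in>lip_ball z. cnorm A (a \<ominus> b) \<le> \<epsilon>" using \<epsilon>(1) by (meson order_trans)
  next
    fix b assume b: "b \<in> lip_ball z"
    have "\<exists>a\<in>lip_ball y. cnorm A (b \<ominus> a) \<le> z N + (1 - t) * z 0"
      by (rule lip_ball_approx[OF b t]) (use close y(1) in auto)
    then show "\<exists>a\<in>lip_ball y. cnorm A (b \<ominus> a) \<le> \<epsilon>" using \<epsilon>(2) by (meson order_trans)
  qed
  finally show ?thesis .
qed

text \<open>
  The common bound \<open>\<beta>\<close> provides one stage \<open>N\<close> for all \<open>k\<close>; pointwise convergence at the
  finitely many \<open>n < N\<close> then makes the factor \<open>t = 1 - \<eta>\<close> admissible for all large \<open>k\<close>.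
\<close>

theorem quantum_propinquity_L_tendsto_0:
  assumes \<beta>: "\<beta> \<longlonglongrightarrow> 0" and xs: "\<And>k. xs k \<in> c_seq \<beta>" and x: "x \<in> c_seq \<beta>"
    and lim: "\<And>n. (\<lambda>k. xs k n) \<longlonglongrightarrow> x n"
  shows "(\<lambda>k. quantum_propinquity (A, L (xs k)) (A, L x)) \<longlonglongrightarrow> 0"
proof -
  have pos: "0 < xs k n" "xs k n \<le> \<beta> n" "0 < x n" "x n \<le> \<beta> n" for k n
    using xs[of k] x by (auto simp: c_seq_def)
  have bound: "\<forall>\<^sub>F k in sequentially. quantum_propinquity (A, L (xs k)) (A, L x) \<le> ennreal \<epsilon>"
    if \<epsilon>: "0 < \<epsilon>" for \<epsilon>
  proof -
    have "\<forall>\<^sub>F n in sequentially. \<beta> n < \<epsilon> / 2"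
      using order_tendstoD(2)[OF \<beta>, of "\<epsilon>/2"] \<epsilon> by simp
    then obtain N where N: "\<beta> N < \<epsilon> / 2" by (auto simp: eventually_sequentially)
    have \<beta>0: "0 < \<beta> 0" using pos(3,4)[of 0] by linarith
    \<comment> \<open>Shrinking by \<open>1 - \<eta>\<close> moves points of the unit balls by at most \<open>\<eta> * \<beta> 0 \<le> \<epsilon> / 2\<close>.\<close>
    define \<eta> where "\<eta> = min (1/2) (\<epsilon> / (2 * \<beta> 0))"
    have \<eta>: "0 < \<eta>" "\<eta> < 1" "\<eta> * \<beta> 0 \<le> \<epsilon> / 2"
    proof -
      have "\<eta> * \<beta> 0 \<le> \<epsilon> / (2 * \<beta> 0) * \<beta> 0" using \<beta>0 by (intro mult_right_mono) (auto simp: \<eta>_def)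
      then show "\<eta> * \<beta> 0 \<le> \<epsilon> / 2" using \<beta>0 by simp
    qed (use \<epsilon> \<beta>0 in \<open>auto simp: \<eta>_def\<close>)
    have "\<forall>\<^sub>F k in sequentially. (1 - \<eta>) * xs k n \<le> x n \<and> (1 - \<eta>) * x n \<le> xs k n" for n
    proof -
      have l1: "(\<lambda>k. (1 - \<eta>) * xs k n) \<longlonglongrightarrow> (1 - \<eta>) * x n"
        by (intro tendsto_intros lim)
      have less: "(1 - \<eta>) * x n < x n" using \<eta>(1) pos(3)[of n] by simp
      have "\<forall>\<^sub>F k in sequentially. (1 - \<eta>) * xs k n < x n"
        using l1 less by (rule order_tendstoD)
      moreover have "\<forall>\<^sub>F k in sequentially. (1 - \<eta>) * x n < xs k n"
        using lim less by (rule order_tendstoD)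
      ultimately show ?thesis by eventually_elim simp
    qed
    then have "\<forall>\<^sub>F k in sequentially. \<forall>n\<in>{..<N}. (1 - \<eta>) * xs k n \<le> x n \<and> (1 - \<eta>) * x n \<le> xs k n"
      by (intro eventually_ball_finite) auto
    then show ?thesis
    proof eventually_elim
      case (elim k)
      show ?case
      proof (rule quantum_propinquity_L_le[where t = "1 - \<eta>" and N = N])
        have *: "w N + \<eta> * w 0 \<le> \<epsilon>" if "\<And>n. w n \<le> \<beta> n" for w
          using that[of N] mult_left_mono[OF that[of 0] less_imp_le[OF \<eta>(1)]] \<eta>(3) N by linarith
        show "xs k N + (1 - (1 - \<eta>)) * xs k 0 \<le> \<epsilon>" "x N + (1 - (1 - \<eta>)) * x 0 \<le> \<epsilon>"
          using *[of "xs k"] *[of x] pos by simp_all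
      qed (use elim xs[of k] x \<eta> in \<open>auto simp: c_seq_def\<close>)
    qed
  qed
  show ?thesis
  proof (rule order_tendstoI)
    fix u :: ennreal assume "0 < u"
    then obtain v where v: "0 < v" "v < u" using dense by blast
    then obtain \<epsilon> where \<epsilon>: "v = ennreal \<epsilon>" "0 < \<epsilon>" by (cases v) auto
    show "\<forall>\<^sub>F k in sequentially. quantum_propinquity (A, L (xs k)) (A, L x) < u"
      using bound[OF \<epsilon>(2)]
    proof eventually_elim
      case (elim k)
      then show ?case using v(2) unfolding \<epsilon>(1) by (rule le_less_trans)
    qed
  qed simp
qed

end

section \<open>Continuity of the Lip-norms of an inductive limit\<close>

theorem theorem8p2:
  fixes A :: "'u cstar" and F :: "nat \<Rightarrow> 'v cstar"
    and \<alpha> :: "nat \<Rightarrow> 'v \<Rightarrow> 'v" and \<iota> :: "nat \<Rightarrow> 'v \<Rightarrow> 'u"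
    and \<mu> :: "'u \<Rightarrow> complex"
    and \<beta> x :: "nat \<Rightarrow> real" and xs :: "nat \<Rightarrow> nat \<Rightarrow> real"
  assumes "inductive_sequence F \<alpha>"
    and "\<And>n. finite_dimensional (F n)"
    and "star_isomorphic complex_cstar (F 0)"
    and "\<And>n. inj_on (\<alpha> n) (carrier (F n))"
    and "inductive_limit F \<alpha> A \<iota>"
    and "faithful_tracial_state A \<mu>"
    and "\<And>n. 0 < \<beta> n" and "\<beta> \<longlonglongrightarrow> 0"
    and "\<And>k. xs k \<in> c_seq \<beta>" and "x \<in> c_seq \<beta>"
    and "\<And>n. (\<lambda>k. xs k n) \<longlonglongrightarrow> x n"
  shows "(\<lambda>k. quantum_propinquity (A, af_lip_norm A F \<iota> \<mu> (xs k)) (A, af_lip_norm A F \<iota> \<mu> x))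
           \<longlonglongrightarrow> 0"
proof -
  have F: "unital_cstar_algebra (F n)" and \<alpha>: "unital_star_hom (F n) (F (Suc n)) (\<alpha> n)" for n
    using assms(1) by (auto simp: inductive_sequence_def)
  have A: "unital_cstar_algebra A" and \<iota>: "unital_star_hom (F n) A (\<iota> n)"
    and cocone: "\<And>a. a \<in> carrier (F n) \<Longrightarrow> \<iota> (Suc n) (\<alpha> n a) = \<iota> n a"
    and closure: "norm_topology A closure_of (\<Union>n. \<iota> n ` carrier (F n)) = carrier A" for n
    using assms(5) by (auto simp: inductive_limit_def)
  interpret tracial_cstar_algebra A \<mu>
    using A assms(6) by (simp add: tracial_cstar_algebra_def tracial_cstar_algebra_axioms_def)
  define B where "B n = \<iota> n ` carrier (F n)" for n
  have "\<exists>es. framed_star_subalgebra A \<mu> (B n) es" for n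
    unfolding B_def by (rule image_framed_star_subalgebra[OF F assms(2) \<iota>])
  then obtain es where es: "\<And>n. framed_star_subalgebra A \<mu> (B n) (es n)" by metis
  \<comment> \<open>The connecting maps make the images increase; the zeroth image consists of the scalars because
    \<open>F 0\<close> is one-dimensional.\<close>
  interpret af_tower A \<mu> B es
  proof (rule af_tower.intro[OF tracial_cstar_algebra_axioms], rule af_tower_axioms.intro)
    show "framed_star_subalgebra A \<mu> (B n) (es n)" for n by (rule es)
    have step: "B n \<subseteq> B (Suc n)" for n
    proof -
      have "\<alpha> n a \<in> carrier (F (Suc n))" if "a \<in> carrier (F n)" for a
        using \<alpha>[of n] that by (auto simp: unital_star_hom_def ring_hom_def)
      then show ?thesis unfolding B_def using cocone by (metis image_eqI image_subsetI)
    qed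
    show "B m \<subseteq> B n" if "m \<le> n" for m n using step that by (rule lift_Suc_mono_le)
    show "B 0 = range (\<lambda>c. c \<odot>\<^bsub>A\<^esub> \<one>\<^bsub>A\<^esub>)"
    proof -
      obtain f where f: "unital_star_hom complex_cstar (F 0) f"
        and bij: "f ` carrier complex_cstar = carrier (F 0)"
        using assms(3) by (auto simp: star_isomorphic_def bij_betw_def)
      interpret F0: unital_cstar_algebra "F 0" by (rule F)
      have "f c = c \<odot>\<^bsub>F 0\<^esub> \<one>\<^bsub>F 0\<^esub>" for c
        using F0.unital_star_hom_props(4)[OF unital_cstar_algebra_complex f, of 1 c]
          F0.unital_star_hom_props(6)[OF unital_cstar_algebra_complex f]
        by (simp add: complex_cstar_def)
      then have B_0: "B 0 = range (\<lambda>c. \<iota> 0 (c \<odot>\<^bsub>F 0\<^esub> \<one>\<^bsub>F 0\<^esub>))"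
        by (simp only: B_def bij[symmetric] complex_cstar_simps image_image)
      have "(\<lambda>c. \<iota> 0 (c \<odot>\<^bsub>F 0\<^esub> \<one>\<^bsub>F 0\<^esub>)) = (\<lambda>c. c \<odot>\<^bsub>A\<^esub> \<one>\<^bsub>A\<^esub>)"
      proof
        fix c
        have "\<iota> 0 (c \<odot>\<^bsub>F 0\<^esub> \<one>\<^bsub>F 0\<^esub>) = c \<odot>\<^bsub>A\<^esub> \<iota> 0 \<one>\<^bsub>F 0\<^esub>"
          by (rule unital_star_hom_props(4)[OF F \<iota>]) (rule F0.one_closed)
        then show "\<iota> 0 (c \<odot>\<^bsub>F 0\<^esub> \<one>\<^bsub>F 0\<^esub>) = c \<odot>\<^bsub>A\<^esub> \<one>\<^bsub>A\<^esub>"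
          by (simp only: unital_star_hom_props(6)[OF F \<iota>])
      qed
      then show ?thesis by (simp only: B_0)
    qed
    show "\<exists>n. \<exists>b\<in>B n. cnorm A (a \<ominus>\<^bsub>A\<^esub> b) < e" if a: "a \<in> carrier A" and e: "0 < e" for a e
    proof -
      interpret M: Metric_space "carrier A" "cstar_dist A" by (rule Metric_space_cstar)
      have "a \<in> M.mtopology closure_of (\<Union>n. B n)"
        using closure a by (simp add: norm_topology_def B_def)
      then obtain n b where "b \<in> B n" "b \<in> M.mball a e"
        using e unfolding M.metric_closure_of by blast
      then show ?thesis by (intro exI[of _ n] bexI[of _ b]) (auto simp: cstar_dist_def)
    qed
  qed
  have "af_lip_norm A F \<iota> \<mu> y = L y" for y
  proof
    fix a
    have "cond_exp_onto A \<mu> (\<iota> n ` carrier (F n)) a = E n a" if "a \<in> selfadjoint A" for n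
      using T.cond_exp_onto_eq[of n] selfadjoint_carrier[OF that] by (simp add: B_def)
    then show "af_lip_norm A F \<iota> \<mu> y a = L y a"
      by (simp add: af_lip_norm_def L_def dev_def)
  qed
  then show ?thesis
    using quantum_propinquity_L_tendsto_0[OF assms(8-11)] by simp
qed

end
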